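(* Let $n,h\ge 1$ be integers, let $\epsilon>0$, and let $F_1,\dots,F_h$ be cumulative distribution functions on $\mathbb{R}$, each of which is either continuous or discrete (a step function). Consider Mechanism 1 (defined in the context) with privacy parameter $\epsilon$, cost distributions $F_1,\dots,F_h$, and a parameter $c\in(0,1)$ that the mechanism may choose freely. Then Mechanism 1 is Bayesian incentive compatible, ex-interim individually rational, $O(\epsilon^{-1})$-accurate, perfectly data private, and $\epsilon$-differentially private. Here the accuracy assertion is for $c$ picked as a constant with $\frac{n(1-c)}{c}\le\frac{2}{\epsilon^2c^2}$: for every $c_0\in(0,1)$ there is a constant $C$ depending only on $c_0$ such that, for all $n,h,\epsilon,F_1,\dots,F_h$ and every $c\in[c_0,1)$ with $\frac{n(1-c)}{c}\le\frac{2}{\epsilon^2c^2}$, Mechanism 1 is $(C/\epsilon)$-accurate. The other four properties hold for every $c\in(0,1)$. The same holds for databases with $d$ attributes, $D_i\in[h]^d$, and the target count $|\{i: D_{ij}=a_j \text{ for all } j\in[d]\}|$ for a given $(a_1,\dots,a_d)\in[h]^d$, when Mechanism 1 is applied to the single-attribute data in $[h^d]$ obtained by encoding $[h]^d$ bijectively as $[h^d]$, with one cost distribution for each element of $[h^d]$ and with the value encoding $(a_1,\dots,a_d)$ in the role of $1$.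
   Context: Setting. There are $n$ players and a database $D\in[h]^n$, where $[h]=\{1,\dots,h\}$; $D_i$ is player $i$'s private data, verifiable once $i$ agrees to its use. Player $i$ with $D_i=j$ has a private cost $v_i$ drawn from $F_j$; costs of different players are independent. The $F_j$ are publicly known. The goal is to estimate $n_1=|\{i:D_i=1\}|$. Notation. $\mathrm{lap}(b)$ is a random variable with the Laplace distribution with density $\frac1{2b}\exp(-|x|/b)$, $b>0$ (and $\mathrm{lap}(0)=0$); different occurrences are independent of each other and of everything else. Mechanism 1. Given $c\in(0,1)$, for each $j\in[h]$: if there is $\alpha_j$ with $F_j(\alpha_j)=c$ (always the case when $F_j$ is continuous), fix such an $\alpha_j$ and put $\alpha_j^-=\alpha_j^+=\alpha_j$. Otherwise $F_j$ is discrete; let $\alpha_j^-$ be the largest and $\alpha_j^+$ the smallest value taken by the cost with positive probability such that $c_j^-:=F_j(\alpha_j^-)<c$ and $c_j^+:=F_j(\alpha_j^+)>c$ (if no value of the first kind exists, $\alpha_j^-$ is any fixed number below $\alpha_j^+$, so $c_j^-=0$), and let $\beta_j=\frac{c-c_j^-}{c_j^+-c_j^-}$. For each player $i$ and each $j$ set $\alpha_{i,j}=\alpha_j$ in the first case; in the second case draw $\alpha_{i,j}$ independently, equal to $\alpha_j^+$ with probability $\beta_j$ and to $\alpha_j^-$ with probability $1-\beta_j$. Thus $\Pr[v_i\le\alpha_{i,j}\mid D_i=j]=c$, over the cost and the draw of $\alpha_{i,j}$. Player $i$ is offered the contract "if $D_i=j$, your expected payment will be $\epsilon\alpha_{i,j}$",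 and player $i$'s action $y_i$ is "accept" or "reject". Let $W$ be the set of players who accept. The mechanism reads all actions, and reads $D_i$ exactly for $i\in W$. Let $m=|\{i\in W: D_i=1\}|$ and $s=\frac1c\left(m+\mathrm{lap}(1/\epsilon)\right)$. The output estimate $\hat s$ is $s$ if $s\in[0,n]$, $0$ if $s<0$, and $n$ if $s>n$. The payments are $p_i=0$ if $i\notin W$, and $p_i=\epsilon\left(\alpha_{i,j}+\mathrm{lap}(\gamma/\epsilon)\right)$ if $i\in W$ and $D_i=j$, where $\gamma=\max_j\alpha_j^+-\min_j\alpha_j^-$. A player $i$ with $D_i=j$ decides truthfully if he accepts exactly when $v_i\le\alpha_{i,j}$. Learning. The mechanism has a prior belief $G$ on the data, with probabilities $\Pr_G[D_i=j]$. It learns about $D_i$ (written $x_i=1$; otherwise $x_i=0$) if it reads $D_i$, or if it reads player $i$'s action $y_i$ and, given that players decide truthfully, its posterior belief on $D_i$ given $y_i$ differs from its prior, where the probabilities of the actions given the data are taken over both the costs and the random choice of the $\alpha_{i,j}$. The utility of player $i$ is $p_i-\epsilon x_iv_i$; thus here it is $p_i-\epsilon v_i$ if $i$ accepts and $0$ if $i$ rejects. Definitions. Bayesian incentive compatible: for every $D$, player $i$ and $v_i$, and whatever contract $i$ is offered, when the other players' costs are drawn from the distributions given by their data and they decide truthfully, deciding truthfully maximizes $i$'s expected utility. Ex-interim individually rational: the expected utility of every player who decides truthfully is non-negative (expectation over the mechanism and the others' costs, the others deciding truthfully). Perfectly data private: when players decide truthfully, whenever $x_i=1$ the expected payment to player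 $i$ is at least $\epsilon v_i$. $k$-accurate: for every database $D$, when every player decides truthfully, $\Pr[|\hat s-n_1|\ge k]\le\frac13$. $\epsilon$-differentially private: for any databases $D,D'$ differing in exactly one entry, with $v$ and $v'$ drawn independently according to $D$ and $D'$ respectively (coordinate $l$ of $v$ from $F_{D_l}$, of $v'$ from $F_{D'_l}$) and players deciding truthfully, the outcomes $(\hat s,p)$ and $(\hat s',p')$ satisfy, for all measurable $I\subseteq\mathbb{R}$ and all $l\in[n]$, $\Pr[\hat s\in I]\le e^\epsilon\Pr[\hat s'\in I]$ and $\Pr[p_l\in I]\le e^\epsilon\Pr[p_l'\in I]$. *)

theory Defs
  imports "HOL-Probability.Probability"
begin

definition laplace :: "real \<Rightarrow> real measure" where
  "laplace b =
     (if b = 0 then return borel 0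
      else density lborel (\<lambda>x. ennreal (exp (- \<bar>x\<bar> / b) / (2 * b))))"

definition discrete_distribution :: "real measure \<Rightarrow> bool" where
  "discrete_distribution M \<longleftrightarrow> (\<exists>S. countable S \<and> measure M S = 1)"

text \<open>
  \<open>thresholds M c l u\<close>: the numbers \<open>l\<close> and \<open>u\<close> are an admissible choice of \<open>\<alpha>\<^sup>-\<close> and \<open>\<alpha>\<^sup>+\<close> for the
  cost distribution \<open>M\<close>.  It is a relation because the choice need not be unique.  If the atoms
  accumulate from the left at the \<open>c\<close>-quantile there may be no largest atom below, and then no
  admissible choice; \<open>thresholds_exist\<close> below shows that this happens neither for a continuous
  distribution function nor for a step function with locally finitely many jumps.
\<close>

definition thresholds :: "real measure \<Rightarrow> real \<Rightarrow> real \<Rightarrow> real \<Rightarrow> bool" where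
  "thresholds M c l u \<longleftrightarrow>
     (if \<exists>a. cdf M a = c then cdf M l = c \<and> u = l
      else
        (let below = {x. 0 < measure M {x} \<and> cdf M x < c};
             above = {x. 0 < measure M {x} \<and> c < cdf M x}
         in u \<in> above \<and> (\<forall>x\<in>above. u \<le> x) \<and>
            (if below = {} then l < u else l \<in> below \<and> (\<forall>x\<in>below. x \<le> l))))"

lemma thresholds_exist:
  assumes M: "real_distribution M" and c: "0 < c" "c < 1"
    and step: "continuous_on UNIV (cdf M) \<or> (\<exists>S. (\<forall>a b. finite (S \<inter> {a..b})) \<and> measure M S = 1)"
  shows "\<exists>l u. thresholds M c l u"
proof (cases "\<exists>a. cdf M a = c")
  case True
  then show ?thesis unfolding thresholds_def by auto
next
  case False
  interpret real_distribution M by (rule M)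
  have "eventually (\<lambda>x. cdf M x < c) at_bot"
    using order_tendstoD(2)[OF cdf_lim_at_bot c(1)] .
  then obtain p where p: "cdf M p < c" by (auto simp: eventually_at_bot_linorder)
  have "eventually (\<lambda>x. c < cdf M x) at_top"
    using order_tendstoD(1)[OF cdf_lim_at_top_prob c(2)] .
  then obtain q where q: "c < cdf M q" by (auto simp: eventually_at_top_linorder)
  have "p < q" using p q cdf_nondecreasing[of q p] by linarith
  have "\<not> continuous_on UNIV (cdf M)"
  proof
    assume "continuous_on UNIV (cdf M)"
    then have "continuous_on {p..q} (cdf M)" by (rule continuous_on_subset) auto
    from IVT'[OF _ _ _ this, of c] p q \<open>p < q\<close> False show False by auto
  qed
  with step obtain S where S: "\<And>a b. finite (S \<inter> {a..b})" "measure M S = 1" by blast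
  have Ssets: "S \<in> sets M" using S(2) by (metis measure_notin_sets zero_neq_one)
  have atom: "x \<in> S" if "0 < measure M {x}" for x
  proof (rule ccontr)
    assume "x \<notin> S"
    then have "measure M (S \<union> {x}) = measure M S + measure M {x}"
      using Ssets by (intro finite_measure_Union) auto
    with that S(2) prob_le_1[of "S \<union> {x}"] show False by simp
  qed
  have ex_atom: "\<exists>s. x < s \<and> s \<le> y \<and> 0 < measure M {s}" if "cdf M x < cdf M y" for x y
  proof (rule ccontr)
    assume no: "\<not> ?thesis"
    have xy: "x < y" using that cdf_nondecreasing[of y x] by linarith
    have fin: "finite (S \<inter> {x<..y})" by (rule finite_subset[OF _ S(1)[of x y]]) auto
    have "AE s in M. s \<in> S" using S(2) Ssets by (simp add: prob_eq_1)
    then have "measure M {x<..y} = measure M (S \<inter> {x<..y})"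
      using Ssets by (intro measure_eq_AE) auto
    also have "\<dots> = (\<Sum>s\<in>S \<inter> {x<..y}. measure M {s})"
      using fin by (intro finite_measure_eq_sum_singleton) auto
    also have "\<dots> = 0" using no by (intro sum.neutral) (auto simp: zero_less_measure_iff)
    finally show False using cdf_diff_eq[OF xy] that by simp
  qed
  define below above where "below = {x. 0 < measure M {x} \<and> cdf M x < c}"
    and "above = {x. 0 < measure M {x} \<and> c < cdf M x}"
  have cmp: "b < a" if "b \<in> below" "a \<in> above" for a b
    using that cdf_nondecreasing[of a b] unfolding below_def above_def by force
  have fin: "finite (X \<inter> {a..b})" if "X \<subseteq> S" for X a b
    by (rule finite_subset[OF _ S(1)[of a b]]) (use that in auto)
  have sub: "below \<subseteq> S" "above \<subseteq> S" using atom by (auto simp: below_def above_def)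
  have gt_p: "p < x" if "c < cdf M x" for x using that p cdf_nondecreasing[of x p] by linarith
  define T where "T = {s. p < s \<and> s \<le> q \<and> 0 < measure M {s}}"
  have T: "finite T" "T \<noteq> {}"
    using ex_atom[of p q] p q by (auto simp: T_def intro!: finite_subset[OF _ S(1)[of p q]] atom)
  define t where "t = Max T"
  have t: "t \<in> T" "\<And>s. s \<in> T \<Longrightarrow> s \<le> t" using T by (auto simp: t_def)
  have "\<not> cdf M t < cdf M q"
  proof
    assume "cdf M t < cdf M q"
    from ex_atom[OF this] obtain s where "t < s" "s \<le> q" "0 < measure M {s}" by blast
    with t(1) have "s \<in> T" by (auto simp: T_def)
    with t(2) \<open>t < s\<close> show False by force
  qed
  with q t(1) have ta: "t \<in> above" by (auto simp: above_def T_def)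
  define u where "u = Min (above \<inter> {p..t})"
  have "t \<in> above \<inter> {p..t}" using ta t(1) by (auto simp: T_def)
  then have "u \<in> above \<inter> {p..t}" and u_min: "\<And>x. x \<in> above \<inter> {p..t} \<Longrightarrow> u \<le> x"
    using fin[OF sub(2), of p t] unfolding u_def by (auto intro!: Min_in simp del: Int_iff)
  then have u: "u \<in> above" "\<forall>x\<in>above. u \<le> x"
    by (force simp: above_def dest: gt_p)+
  have "\<exists>l. if below = {} then l < u else l \<in> below \<and> (\<forall>x\<in>below. x \<le> l)"
  proof (cases "below = {}")
    case True
    then show ?thesis by (auto intro: exI[of _ "u - 1"])
  next
    case nonempty: False
    then obtain b where b: "b \<in> below" by blast
    define l where "l = Max (below \<inter> {b..u})"
    have "b \<in> below \<inter> {b..u}" using b cmp[OF b u(1)] by auto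
    then have "l \<in> below \<inter> {b..u}" and l_max: "\<And>x. x \<in> below \<inter> {b..u} \<Longrightarrow> x \<le> l"
      using fin[OF sub(1), of b u] unfolding l_def by (auto intro!: Max_in simp del: Int_iff)
    moreover have "x \<le> l" if "x \<in> below" for x
      using that l_max[of x] cmp[OF that u(1)] calculation(1) by force
    ultimately show ?thesis using nonempty by auto
  qed
  then obtain l where "if below = {} then l < u else l \<in> below \<and> (\<forall>x\<in>below. x \<le> l)" ..
  with False u have "thresholds M c l u"
    unfolding thresholds_def Let_def below_def above_def by auto
  then show ?thesis by blast
qed

text \<open>
  An instance of the mechanism.  Players are \<open>1, \<dots>, n\<close>.  A player's data is an element of
  \<open>data_values\<close>, and \<open>code\<close> maps it to the value in \<open>{1..num_codes}\<close> on which the mechanism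
  operates.  The mechanism counts the players whose data has code \<open>target\<close>.
\<close>

record 'x mechanism =
  num_players :: nat
  data_values :: "'x set"
  code :: "'x \<Rightarrow> nat"
  num_codes :: nat
  target :: nat
  privacy :: real
  accept_prob :: real
  cost_dist :: "nat \<Rightarrow> real measure"
  thr_lo :: "nat \<Rightarrow> real"
  thr_hi :: "nat \<Rightarrow> real"
  prior :: "(nat \<Rightarrow> 'x) pmf"

definition players :: "'x mechanism \<Rightarrow> nat set" where
  "players P = {1..num_players P}"

definition databases :: "'x mechanism \<Rightarrow> (nat \<Rightarrow> 'x) set" where
  "databases P = players P \<rightarrow>\<^sub>E data_values P"

definition beta :: "'x mechanism \<Rightarrow> nat \<Rightarrow> real" where
  "beta P j = (accept_prob P - cdf (cost_dist P j) (thr_lo P j)) /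
     (cdf (cost_dist P j) (thr_hi P j) - cdf (cost_dist P j) (thr_lo P j))"

text \<open>When the two thresholds coincide this is a point mass, whatever the value of \<open>beta\<close>.\<close>

definition threshold_law :: "'x mechanism \<Rightarrow> nat \<Rightarrow> real measure" where
  "threshold_law P j =
     distr (measure_pmf (bernoulli_pmf (beta P j))) borel
       (\<lambda>b. if b then thr_hi P j else thr_lo P j)"

definition gamma :: "'x mechanism \<Rightarrow> real" where
  "gamma P = Max (thr_hi P ` {1..num_codes P}) - Min (thr_lo P ` {1..num_codes P})"

text \<open>The contracts that a player may be offered: \<open>a j\<close> is the threshold for data with code \<open>j\<close>.\<close>

definition contracts :: "'x mechanism \<Rightarrow> (nat \<Rightarrow> real) set" where
  "contracts P = (\<Pi>\<^sub>E j\<in>{1..num_codes P}. {thr_lo P j, thr_hi P j})"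

definition payment_noise :: "'x mechanism \<Rightarrow> (nat \<Rightarrow> real) measure" where
  "payment_noise P = (\<Pi>\<^sub>M i\<in>players P. laplace (gamma P / privacy P))"

text \<open>
  The probability space for database \<open>D\<close>.  A sample \<open>(v, A, z, w)\<close> consists of the costs \<open>v i\<close>, the
  thresholds \<open>A i j\<close> (so that \<open>A i\<close> is the contract offered to player \<open>i\<close>), the noise \<open>z\<close> added to the
  count, and the noise \<open>w i\<close> in the payment to player \<open>i\<close>, all independent.
\<close>

definition randomness ::
    "'x mechanism \<Rightarrow> (nat \<Rightarrow> 'x) \<Rightarrow>
     ((nat \<Rightarrow> real) \<times> (nat \<Rightarrow> nat \<Rightarrow> real) \<times> real \<times> (nat \<Rightarrow> real)) measure" where
  "randomness P D =
     (\<Pi>\<^sub>M i\<in>players P. cost_dist P (code P (D i))) \<Otimes>\<^sub>M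
     (\<Pi>\<^sub>M i\<in>players P. \<Pi>\<^sub>M j\<in>{1..num_codes P}. threshold_law P j) \<Otimes>\<^sub>M
     laplace (1 / privacy P) \<Otimes>\<^sub>M
     payment_noise P"

text \<open>Actions are Booleans: \<open>y i\<close> holds iff player \<open>i\<close> accepts.\<close>

definition truthful ::
    "'x mechanism \<Rightarrow> (nat \<Rightarrow> 'x) \<Rightarrow> (nat \<Rightarrow> real) \<Rightarrow> (nat \<Rightarrow> nat \<Rightarrow> real) \<Rightarrow> nat \<Rightarrow> bool" where
  "truthful P D v A i \<longleftrightarrow> v i \<le> A i (code P (D i))"

definition estimate ::
    "'x mechanism \<Rightarrow> (nat \<Rightarrow> 'x) \<Rightarrow> (nat \<Rightarrow> bool) \<Rightarrow> real \<Rightarrow> real" where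
  "estimate P D y z =
     (let m = card {i \<in> players P. y i \<and> code P (D i) = target P};
          s = (real m + z) / accept_prob P
      in if s < 0 then 0 else if s > real (num_players P) then real (num_players P) else s)"

definition payment ::
    "'x mechanism \<Rightarrow> (nat \<Rightarrow> 'x) \<Rightarrow> (nat \<Rightarrow> nat \<Rightarrow> real) \<Rightarrow> (nat \<Rightarrow> bool) \<Rightarrow> (nat \<Rightarrow> real) \<Rightarrow>
     nat \<Rightarrow> real" where
  "payment P D A y w i = (if y i then privacy P * (A i (code P (D i)) + w i) else 0)"

text \<open>The probability that a truthful player with data \<open>x\<close> takes the action \<open>b\<close>.\<close>

definition action_prob :: "'x mechanism \<Rightarrow> 'x \<Rightarrow> bool \<Rightarrow> real" where
  "action_prob P x b =
     \<P>((v, a) in cost_dist P (code P x) \<Otimes>\<^sub>M threshold_law P (code P x). (v \<le> a) = b)"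

definition prior_prob :: "'x mechanism \<Rightarrow> nat \<Rightarrow> 'x \<Rightarrow> real" where
  "prior_prob P i x = measure_pmf.prob (prior P) {D. D i = x}"

definition posterior_prob :: "'x mechanism \<Rightarrow> nat \<Rightarrow> bool \<Rightarrow> 'x \<Rightarrow> real" where
  "posterior_prob P i b x =
     prior_prob P i x * action_prob P x b /
       (\<Sum>x'\<in>data_values P. prior_prob P i x' * action_prob P x' b)"

text \<open>
  All actions are read, and the data of exactly those players who accept; hence the first
  disjunct says that the data of player \<open>i\<close> is read.
\<close>

definition learns :: "'x mechanism \<Rightarrow> (nat \<Rightarrow> bool) \<Rightarrow> nat \<Rightarrow> bool" where
  "learns P y i \<longleftrightarrow>
     y i \<or> (\<exists>x\<in>data_values P. posterior_prob P i (y i) x \<noteq> prior_prob P i x)"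

definition utility ::
    "'x mechanism \<Rightarrow> (nat \<Rightarrow> 'x) \<Rightarrow> (nat \<Rightarrow> real) \<Rightarrow> (nat \<Rightarrow> nat \<Rightarrow> real) \<Rightarrow> (nat \<Rightarrow> bool) \<Rightarrow>
     (nat \<Rightarrow> real) \<Rightarrow> nat \<Rightarrow> real" where
  "utility P D v A y w i = payment P D A y w i - privacy P * of_bool (learns P y i) * v i"

text \<open>
  The utility of player \<open>i\<close> as a random variable, when he has cost \<open>t\<close>, is offered the contract \<open>a\<close>
  and takes the action \<open>b\<close>, and everyone else decides truthfully.  The coordinates of the sample
  that belong to player \<open>i\<close>'s cost and contract are overwritten.
\<close>

definition deviation_utility ::
    "'x mechanism \<Rightarrow> (nat \<Rightarrow> 'x) \<Rightarrow> nat \<Rightarrow> real \<Rightarrow> (nat \<Rightarrow> real) \<Rightarrow> bool \<Rightarrow>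
     (nat \<Rightarrow> real) \<times> (nat \<Rightarrow> nat \<Rightarrow> real) \<times> real \<times> (nat \<Rightarrow> real) \<Rightarrow> real" where
  "deviation_utility P D i t a b =
     (\<lambda>(v, A, z, w).
        let v' = v(i := t); A' = A(i := a); y = (truthful P D v' A')(i := b)
        in utility P D v' A' y w i)"

text \<open>
  Wherever an expectation occurs below, integrability is part of the property, since the Bochner
  integral of a non-integrable function is 0 by convention.
\<close>

definition bayesian_incentive_compatible :: "'x mechanism \<Rightarrow> bool" where
  "bayesian_incentive_compatible P \<longleftrightarrow>
     (\<forall>D\<in>databases P. \<forall>i\<in>players P. \<forall>t. \<forall>a\<in>contracts P. \<forall>b.
        integrable (randomness P D) (deviation_utility P D i t a b) \<and>
        (\<integral>\<omega>. deviation_utility P D i t a b \<omega> \<partial>randomness P D)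
          \<le> (\<integral>\<omega>. deviation_utility P D i t a (t \<le> a (code P (D i))) \<omega> \<partial>randomness P D))"

definition truthful_utility ::
    "'x mechanism \<Rightarrow> (nat \<Rightarrow> 'x) \<Rightarrow> nat \<Rightarrow> real \<Rightarrow>
     (nat \<Rightarrow> real) \<times> (nat \<Rightarrow> nat \<Rightarrow> real) \<times> real \<times> (nat \<Rightarrow> real) \<Rightarrow> real" where
  "truthful_utility P D i t =
     (\<lambda>(v, A, z, w). let v' = v(i := t) in utility P D v' A (truthful P D v' A) w i)"

definition ex_interim_individually_rational :: "'x mechanism \<Rightarrow> bool" where
  "ex_interim_individually_rational P \<longleftrightarrow>
     (\<forall>D\<in>databases P. \<forall>i\<in>players P. \<forall>t.
        integrable (randomness P D) (truthful_utility P D i t) \<and>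
        0 \<le> (\<integral>\<omega>. truthful_utility P D i t \<omega> \<partial>randomness P D))"

text \<open>
  The expected payment is taken for each realisation of the costs and of the contracts, that is,
  over the payment noise only.
\<close>

definition perfectly_data_private :: "'x mechanism \<Rightarrow> bool" where
  "perfectly_data_private P \<longleftrightarrow>
     (\<forall>D\<in>databases P. \<forall>v. \<forall>A\<in>players P \<rightarrow> contracts P. \<forall>i\<in>players P.
        let y = truthful P D v A in
        learns P y i \<longrightarrow>
          integrable (payment_noise P) (\<lambda>w. payment P D A y w i) \<and>
          privacy P * v i \<le> (\<integral>w. payment P D A y w i \<partial>payment_noise P))"

text \<open>Here \<open>N D\<close> is the quantity that is to be estimated.\<close>

definition accurate :: "'x mechanism \<Rightarrow> ((nat \<Rightarrow> 'x) \<Rightarrow> nat) \<Rightarrow> real \<Rightarrow> bool" where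
  "accurate P N k \<longleftrightarrow>
     (\<forall>D\<in>databases P.
        \<P>((v, A, z, w) in randomness P D.
            k \<le> \<bar>estimate P D (truthful P D v A) z - real (N D)\<bar>) \<le> 1 / 3)"

definition differentially_private :: "'x mechanism \<Rightarrow> real \<Rightarrow> bool" where
  "differentially_private P e \<longleftrightarrow>
     (\<forall>D\<in>databases P. \<forall>D'\<in>databases P. (\<exists>!i. i \<in> players P \<and> D i \<noteq> D' i) \<longrightarrow>
        (\<forall>I\<in>sets borel.
           \<P>((v, A, z, w) in randomness P D. estimate P D (truthful P D v A) z \<in> I)
             \<le> exp e *
               \<P>((v, A, z, w) in randomness P D'. estimate P D' (truthful P D' v A) z \<in> I) \<and>
           (\<forall>l\<in>players P.
              \<P>((v, A, z, w) in randomness P D. payment P D A (truthful P D v A) w l \<in> I)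
                \<le> exp e *
                  \<P>((v, A, z, w) in randomness P D'. payment P D' A (truthful P D' v A) w l \<in> I))))"

definition admissible ::
    "nat \<Rightarrow> nat \<Rightarrow> real \<Rightarrow> real \<Rightarrow> (nat \<Rightarrow> real measure) \<Rightarrow> (nat \<Rightarrow> real) \<Rightarrow> (nat \<Rightarrow> real) \<Rightarrow> bool" where
  "admissible n h \<epsilon> c F l u \<longleftrightarrow>
     1 \<le> n \<and> 1 \<le> h \<and> 0 < \<epsilon> \<and> 0 < c \<and> c < 1 \<and>
     (\<forall>j\<in>{1..h}.
        real_distribution (F j) \<and>
        (continuous_on UNIV (cdf (F j)) \<or> discrete_distribution (F j)) \<and>
        thresholds (F j) c (l j) (u j))"

definition single_attribute ::
    "nat \<Rightarrow> nat \<Rightarrow> real \<Rightarrow> real \<Rightarrow> (nat \<Rightarrow> real measure) \<Rightarrow> (nat \<Rightarrow> real) \<Rightarrow> (nat \<Rightarrow> real) \<Rightarrow>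
     (nat \<Rightarrow> nat) pmf \<Rightarrow> nat mechanism" where
  "single_attribute n h \<epsilon> c F l u G =
     \<lparr>num_players = n, data_values = {1..h}, code = (\<lambda>x. x), num_codes = h, target = 1,
      privacy = \<epsilon>, accept_prob = c, cost_dist = F, thr_lo = l, thr_hi = u, prior = G\<rparr>"

definition records :: "nat \<Rightarrow> nat \<Rightarrow> (nat \<Rightarrow> nat) set" where
  "records h d = {1..d} \<rightarrow>\<^sub>E {1..h}"

definition multi_attribute ::
    "nat \<Rightarrow> nat \<Rightarrow> nat \<Rightarrow> ((nat \<Rightarrow> nat) \<Rightarrow> nat) \<Rightarrow> (nat \<Rightarrow> nat) \<Rightarrow> real \<Rightarrow> real \<Rightarrow>
     (nat \<Rightarrow> real measure) \<Rightarrow> (nat \<Rightarrow> real) \<Rightarrow> (nat \<Rightarrow> real) \<Rightarrow> (nat \<Rightarrow> nat \<Rightarrow> nat) pmf \<Rightarrow>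
     (nat \<Rightarrow> nat) mechanism" where
  "multi_attribute n h d enc a \<epsilon> c F l u G =
     \<lparr>num_players = n, data_values = records h d, code = enc, num_codes = h ^ d, target = enc a,
      privacy = \<epsilon>, accept_prob = c, cost_dist = F, thr_lo = l, thr_hi = u, prior = G\<rparr>"

end

theory Submission
  imports Defs
begin

text \<open>
  Over the cost and the draw of the threshold, a truthful player accepts with probability exactly
  \<open>c\<close>, whatever his data.  Hence the vector of decisions is a vector of independent Bernoulli
  variables whose law does not depend on the database.  This drives everything: rejecting reveals
  nothing, so accepting is the only action with a privacy cost; changing one entry of the database
  can be coupled so that the decisions stay the same and the count moves by at most one, which the
  noise of scale \<open>1 / \<epsilon>\<close> hides; a payment is 0 with the same probability \<open>1 - c\<close> for all data and
  otherwise a threshold, known up to \<open>\<gamma>\<close>, plus noise of scale \<open>\<gamma> / \<epsilon>\<close>; and the count is binomial, so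
  the estimate has variance at most \<open>n (1 - c) / c + 2 / (\<epsilon>\<^sup>2 c\<^sup>2)\<close> before truncation, to which
  Chebyshev's inequality applies.
\<close>

section \<open>The Laplace distribution\<close>

text \<open>The coupling of two databases is never constructed. Both decision vectors have the law
  \<open>acceptances\<close>, so each probability about the estimate is an integral over that one
  law, and the two integrands can be compared at every fixed vector of decisions.

  When a distribution function jumps over c, a player accepts more often at the upper threshold than
  at the lower one, so acceptance and the amount paid are dependent, in a way that varies with the
  data. Common to all data are the probability c of accepting and one finite set of thresholds.
  Hence the payment probability is bounded on both sides, for all databases at once, in terms of the
  least noise probability over that set.

  Accordingly the fourfold sample space is reduced in two ways: to all decisions together with the
  count noise for the estimate, and to one player's cost, threshold and noise for the
  payment.\<close>

lemma sets_laplace [simp, measurable_cong]: "sets (laplace b) = sets borel"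
  by (simp add: laplace_def)

lemma space_laplace [simp]: "space (laplace b) = UNIV"
  using sets_eq_imp_space_eq[OF sets_laplace] by simp

text \<open>For x >= 0 the Laplace density is half the exponential density of rate 1 / b, that is,
  half the Erlang density with index 0. One half line is enough, since parity then yields the
  moments on the whole line.\<close>

lemma half_laplace_moment:
  assumes "0 < b"
  shows "has_bochner_integral lborel
    (\<lambda>x::real. indicator {0..} x *\<^sub>R ((exp (- \<bar>x\<bar> / b) / (2 * b)) * x ^ k)) (fact k * b ^ k / 2)"
proof -
  have "has_bochner_integral lborel (\<lambda>x. exponential_density (1 / b) x * x ^ k) (fact k * b ^ k)"
  proof (rule has_bochner_integral_nn_integral)
    show "AE x in lborel. 0 \<le> exponential_density (1 / b) x * x ^ k"
      using assms by (intro AE_I2) (simp add: exponential_density_def)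
    show "(\<integral>\<^sup>+x. ennreal (exponential_density (1 / b) x * x ^ k) \<partial>lborel) = ennreal (fact k * b ^ k)"
      using nn_integral_erlang_ith_moment[of "1 / b" 0 k] assms by (simp add: power_one_over)
  qed (use assms in auto)
  then have "has_bochner_integral lborel
      (\<lambda>x. (exponential_density (1 / b) x * x ^ k) * (1 / 2)) (fact k * b ^ k * (1 / 2))"
    by (rule has_bochner_integral_mult_left)
  then show ?thesis
    by (rule has_bochner_integral_cong[THEN iffD1, rotated -1])
      (auto simp: exponential_density_def indicator_def field_simps)
qed

lemma laplace_moment:
  assumes "0 < b" "even k"
  shows "has_bochner_integral (laplace b) (\<lambda>x. x ^ k) (fact k * b ^ k)"
proof -
  have "has_bochner_integral lborel (\<lambda>x. (exp (- \<bar>x\<bar> / b) / (2 * b)) * x ^ k)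
      (2 *\<^sub>R (fact k * b ^ k / 2))"
    by (rule has_bochner_integral_even_function[OF half_laplace_moment]) (use assms in auto)
  then show ?thesis
    using assms unfolding laplace_def
    by (simp, intro has_bochner_integral_density) auto
qed

lemma laplace_odd_moment:
  assumes "0 < b" "odd k"
  shows "has_bochner_integral (laplace b) (\<lambda>x. x ^ k) 0"
proof -
  have "has_bochner_integral lborel (\<lambda>x. (exp (- \<bar>x\<bar> / b) / (2 * b)) * x ^ k) 0"
    by (rule has_bochner_integral_odd_function[OF half_laplace_moment]) (use assms in auto)
  then show ?thesis
    using assms unfolding laplace_def
    by (simp, intro has_bochner_integral_density) auto
qed

text \<open>For positive b the total mass is the zeroth moment. The point mass at b = 0 really
  occurs: \<open>gamma P\<close> vanishes when all thresholds are equal.\<close>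

lemma prob_space_laplace:
  assumes "0 \<le> b"
  shows "prob_space (laplace b)"
proof (cases "b = 0")
  case True
  then show ?thesis by (auto simp: laplace_def intro: prob_space_return)
next
  case False
  with assms have "has_bochner_integral (laplace b) (\<lambda>x. 1 :: real) 1"
    using laplace_moment[of b 0] by simp
  then have "integrable (laplace b) (\<lambda>x. 1 :: real)" "(\<integral>x. (1 :: real) \<partial>laplace b) = 1"
    by (auto simp: has_bochner_integral_iff simp del: lebesgue_integral_const)
  then have "(\<integral>\<^sup>+x. ennreal 1 \<partial>laplace b) = ennreal 1"
    by (subst nn_integral_eq_integral) auto
  then show ?thesis by (intro prob_spaceI) simp
qed

lemma laplace_mean:
  assumes "0 \<le> b"
  shows "has_bochner_integral (laplace b) (\<lambda>x. x) 0"
proof (cases "b = 0")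
  case True
  interpret prob_space "laplace b" using assms by (rule prob_space_laplace)
  have "AE x in laplace b. x = 0" unfolding True laplace_def by (simp, subst AE_return) auto
  then have "has_bochner_integral (laplace b) (\<lambda>x. x) 0 \<longleftrightarrow> has_bochner_integral (laplace b) (\<lambda>x. 0::real) 0"
    by (intro has_bochner_integral_cong_AE) auto
  then show ?thesis by (simp add: has_bochner_integral_zero)
next
  case False
  with assms show ?thesis using laplace_odd_moment[of b 1] by simp
qed

text \<open>By the triangle inequality in the exponent, the densities centred at a and a' differ by
  a factor of at most exp (|a - a'| / b). The hypothesis avoids division so that it also covers b =
  0, where it forces a = a'.\<close>

lemma laplace_shift:
  assumes b: "0 \<le> b" and e: "0 \<le> e" and a: "\<bar>a - a'\<bar> \<le> e * b" and [measurable]: "I \<in> sets borel"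
  shows "measure (laplace b) {w. a + w \<in> I} \<le> exp e * measure (laplace b) {w. a' + w \<in> I}"
proof -
  interpret prob_space "laplace b" using b by (rule prob_space_laplace)
  show ?thesis
  proof (cases "b = 0")
    case True
    then show ?thesis using a e by (auto simp: laplace_def measure_return indicator_def)
  next
    case False
    with b have b: "0 < b" by simp
    define f :: "real \<Rightarrow> real" where "f x = exp (- \<bar>x\<bar> / b) / (2 * b)" for x
    have [measurable]: "f \<in> borel_measurable borel" unfolding f_def[abs_def] by measurable
    \<comment> \<open>The substitution x = s + w moves the shift from the event to the density, so
      that the two measures become integrals over the same set.\<close>
    have em: "emeasure (laplace b) {w. s + w \<in> I} = (\<integral>\<^sup>+x. ennreal (f (x - s)) * indicator I x \<partial>lborel)" for s
    proof -
      have "emeasure (laplace b) {w. s + w \<in> I} = (\<integral>\<^sup>+x. ennreal (f x) * indicator {w. s + w \<in> I} x \<partial>lborel)"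
        using b by (simp add: laplace_def emeasure_density f_def)
      also have "\<dots> = (\<integral>\<^sup>+x. ennreal (f (- s + 1 * x)) * indicator {w. s + w \<in> I} (- s + 1 * x) \<partial>lborel)"
        using nn_integral_real_affine[of "\<lambda>x. ennreal (f x) * indicator {w. s + w \<in> I} x" 1 "- s"] by simp
      also have "\<dots> = (\<integral>\<^sup>+x. ennreal (f (x - s)) * indicator I x \<partial>lborel)"
        by (intro nn_integral_cong) (auto simp: indicator_def)
      finally show ?thesis .
    qed
    have le: "f (x - a) \<le> exp e * f (x - a')" for x
    proof -
      have "\<bar>x - a'\<bar> \<le> \<bar>x - a\<bar> + e * b" using a by linarith
      then have "- \<bar>x - a\<bar> / b \<le> e + - \<bar>x - a'\<bar> / b" using b by (simp add: field_simps)
      then have "exp (- \<bar>x - a\<bar> / b) \<le> exp e * exp (- \<bar>x - a'\<bar> / b)"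
        by (metis exp_add exp_le_cancel_iff)
      then show ?thesis using b by (simp add: f_def divide_right_mono)
    qed
    have "emeasure (laplace b) {w. a + w \<in> I} \<le> (\<integral>\<^sup>+x. ennreal (exp e) * (ennreal (f (x - a')) * indicator I x) \<partial>lborel)"
      unfolding em using le
      by (intro nn_integral_mono) (auto simp: indicator_def ennreal_mult'[symmetric] intro: ennreal_leI)
    also have "\<dots> = ennreal (exp e) * emeasure (laplace b) {w. a' + w \<in> I}"
      unfolding em by (intro nn_integral_cmult) simp
    finally show ?thesis
      by (simp add: emeasure_eq_measure ennreal_mult'[symmetric])
  qed
qed

section \<open>Measure-preserving maps on product spaces\<close>

lemma prob_space_pair:
  "prob_space M \<Longrightarrow> prob_space N \<Longrightarrow> prob_space (M \<Otimes>\<^sub>M N)"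
proof -
  assume "prob_space M" "prob_space N"
  then interpret M: prob_space M + N: prob_space N .
  interpret pair_prob_space M N ..
  show ?thesis by unfold_locales
qed

lemma distr_pair_map:
  assumes N: "prob_space N'" and f: "f \<in> measurable M M'" and g: "g \<in> measurable N N'"
    and "distr M M' f = M'" "distr N N' g = N'"
  shows "distr (M \<Otimes>\<^sub>M N) (M' \<Otimes>\<^sub>M N') (\<lambda>(x, y). (f x, g y)) = M' \<Otimes>\<^sub>M N'"
  using pair_measure_distr[OF f g] assms by (simp add: prob_space_imp_sigma_finite)

lemma distr_snd_comp:
  assumes M: "prob_space M" and N: "prob_space N" and g: "g \<in> measurable N N'" and "distr N N' g = N'"
  shows "distr (M \<Otimes>\<^sub>M N) N' (\<lambda>(x, y). g y) = N'"
proof -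
  interpret M: prob_space M by (rule M)
  interpret N: prob_space N by (rule N)
  have "distr (M \<Otimes>\<^sub>M N) N snd = N"
  proof (rule measure_eqI)
    fix A assume A: "A \<in> sets (distr (M \<Otimes>\<^sub>M N) N snd)"
    then have "snd -` A \<inter> space (M \<Otimes>\<^sub>M N) = space M \<times> A"
      using sets.sets_into_space[of A N] by (auto simp: space_pair_measure)
    with A show "emeasure (distr (M \<Otimes>\<^sub>M N) N snd) A = emeasure N A"
      by (simp add: emeasure_distr N.emeasure_pair_measure_Times M.emeasure_space_1)
  qed simp
  moreover have "distr (M \<Otimes>\<^sub>M N) N' (\<lambda>(x, y). g y) = distr (distr (M \<Otimes>\<^sub>M N) N snd) N' g"
    using g by (subst distr_distr) (auto simp: comp_def case_prod_beta')
  ultimately show ?thesis using assms by simp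
qed

text \<open>The factors of the sample space are nested to the right, so the pair (a, b) that
  determines all decisions is not a factor by itself and cannot be mapped on its own. On rectangles
  Tonelli's theorem integrates y away and splits off the factor for x, and rectangles determine a
  product measure.\<close>

lemma distr_pair_regroup:
  assumes "prob_space M1" "prob_space M2" "prob_space M3" "prob_space M4"
    and f[measurable]: "f \<in> measurable (M1 \<Otimes>\<^sub>M M2) N" and distr: "distr (M1 \<Otimes>\<^sub>M M2) N f = N"
  shows "distr (M1 \<Otimes>\<^sub>M M2 \<Otimes>\<^sub>M M3 \<Otimes>\<^sub>M M4) (N \<Otimes>\<^sub>M M3) (\<lambda>(a, b, x, y). (f (a, b), x)) = N \<Otimes>\<^sub>M M3"
proof (rule sym, rule pair_measure_eqI)
  interpret M1: prob_space M1 by fact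
  interpret M2: prob_space M2 by fact
  interpret M3: prob_space M3 by fact
  interpret M4: prob_space M4 by fact
  interpret M12: pair_prob_space M1 M2 ..
  interpret M34: pair_prob_space M3 M4 ..
  interpret M234: pair_prob_space M2 "M3 \<Otimes>\<^sub>M M4" ..
  have "prob_space N" using M12.prob_space_distr[OF f] distr by simp
  then show "sigma_finite_measure N" by (rule prob_space_imp_sigma_finite)
  show "sigma_finite_measure M3" by unfold_locales
  fix A B assume [measurable]: "A \<in> sets N" "B \<in> sets M3"
  let ?Q = "\<lambda>(a, b, x, y). (f (a, b), x)"
  have Q[measurable]: "?Q \<in> measurable (M1 \<Otimes>\<^sub>M M2 \<Otimes>\<^sub>M M3 \<Otimes>\<^sub>M M4) (N \<Otimes>\<^sub>M M3)" by measurable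
  have "emeasure (distr (M1 \<Otimes>\<^sub>M M2 \<Otimes>\<^sub>M M3 \<Otimes>\<^sub>M M4) (N \<Otimes>\<^sub>M M3) ?Q) (A \<times> B) =
      (\<integral>\<^sup>+p. indicator (A \<times> B) p \<partial>distr (M1 \<Otimes>\<^sub>M M2 \<Otimes>\<^sub>M M3 \<Otimes>\<^sub>M M4) (N \<Otimes>\<^sub>M M3) ?Q)"
    by simp
  also have "\<dots> = (\<integral>\<^sup>+p. indicator (A \<times> B) (?Q p) \<partial>(M1 \<Otimes>\<^sub>M M2 \<Otimes>\<^sub>M M3 \<Otimes>\<^sub>M M4))"
    by (rule nn_integral_distr) measurable
  also have "\<dots> = (\<integral>\<^sup>+a. \<integral>\<^sup>+q. indicator (A \<times> B) (?Q (a, q)) \<partial>(M2 \<Otimes>\<^sub>M M3 \<Otimes>\<^sub>M M4) \<partial>M1)"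
    by (rule M234.nn_integral_fst[symmetric]) measurable
  also have "\<dots> = (\<integral>\<^sup>+a. \<integral>\<^sup>+b. indicator A (f (a, b)) * emeasure M3 B \<partial>M2 \<partial>M1)"
  proof (intro nn_integral_cong)
    fix a assume [measurable]: "a \<in> space M1"
    have "(\<integral>\<^sup>+q. indicator (A \<times> B) (?Q (a, q)) \<partial>(M2 \<Otimes>\<^sub>M M3 \<Otimes>\<^sub>M M4)) =
        (\<integral>\<^sup>+b. \<integral>\<^sup>+r. indicator (A \<times> B) (?Q (a, b, r)) \<partial>(M3 \<Otimes>\<^sub>M M4) \<partial>M2)"
      by (rule M34.nn_integral_fst[symmetric]) measurable
    also have "\<dots> = (\<integral>\<^sup>+b. indicator A (f (a, b)) * emeasure M3 B \<partial>M2)"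
    proof (intro nn_integral_cong)
      fix b assume [measurable]: "b \<in> space M2"
      have "(\<integral>\<^sup>+r. indicator (A \<times> B) (?Q (a, b, r)) \<partial>(M3 \<Otimes>\<^sub>M M4)) =
          (\<integral>\<^sup>+x. \<integral>\<^sup>+y. indicator (A \<times> B) (?Q (a, b, x, y)) \<partial>M4 \<partial>M3)"
        by (rule M4.nn_integral_fst[symmetric]) measurable
      also have "\<dots> = (\<integral>\<^sup>+x. indicator A (f (a, b)) * indicator B x \<partial>M3)"
        by (intro nn_integral_cong) (auto simp: indicator_def M4.emeasure_space_1)
      also have "\<dots> = indicator A (f (a, b)) * emeasure M3 B"
        by (simp add: nn_integral_cmult)
      finally show "(\<integral>\<^sup>+r. indicator (A \<times> B) (?Q (a, b, r)) \<partial>(M3 \<Otimes>\<^sub>M M4)) =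
          indicator A (f (a, b)) * emeasure M3 B" .
    qed
    finally show "(\<integral>\<^sup>+q. indicator (A \<times> B) (?Q (a, q)) \<partial>(M2 \<Otimes>\<^sub>M M3 \<Otimes>\<^sub>M M4)) =
        (\<integral>\<^sup>+b. indicator A (f (a, b)) * emeasure M3 B \<partial>M2)" .
  qed
  also have "\<dots> = (\<integral>\<^sup>+p. indicator A (f p) * emeasure M3 B \<partial>(M1 \<Otimes>\<^sub>M M2))"
    by (rule M2.nn_integral_fst) measurable
  also have "\<dots> = (\<integral>\<^sup>+p. indicator A (f p) \<partial>(M1 \<Otimes>\<^sub>M M2)) * emeasure M3 B"
    by (rule nn_integral_multc) measurable
  also have "(\<integral>\<^sup>+p. indicator A (f p) \<partial>(M1 \<Otimes>\<^sub>M M2)) = (\<integral>\<^sup>+p. indicator A p \<partial>distr (M1 \<Otimes>\<^sub>M M2) N f)"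
    by (rule nn_integral_distr[symmetric]) measurable
  also have "\<dots> = emeasure N A" unfolding distr by simp
  finally show "emeasure N A * emeasure M3 B =
    emeasure (distr (M1 \<Otimes>\<^sub>M M2 \<Otimes>\<^sub>M M3 \<Otimes>\<^sub>M M4) (N \<Otimes>\<^sub>M M3) ?Q) (A \<times> B)" ..
qed simp

lemma has_bochner_integral_measure_preserving:
  fixes f :: "'a \<Rightarrow> real"
  assumes g: "g \<in> measurable M N" and f: "f \<in> borel_measurable N"
    and distr: "distr M N g = N" and int: "has_bochner_integral N f x"
  shows "has_bochner_integral M (\<lambda>x. f (g x)) x"
  using int integrable_distr_eq[OF g f] integral_distr[OF g f]
  by (simp add: distr has_bochner_integral_iff)

section \<open>The acceptance probability\<close>

text \<open>For the case in which no atom lies below the level c and the lower threshold is an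
  arbitrary number: the mass up to l is a sum over atoms, and no atom is there.\<close>

lemma cdf_eq_0_if_atoms_above:
  assumes M: "real_distribution M" and disc: "discrete_distribution M"
    and above: "\<And>x. 0 < measure M {x} \<Longrightarrow> l < x"
  shows "cdf M l = 0"
proof -
  interpret real_distribution M by (rule M)
  obtain S where S: "countable S" "measure M S = 1" using disc by (auto simp: discrete_distribution_def)
  have Ssets: "S \<in> sets M" using S(2) by (metis measure_notin_sets zero_neq_one)
  have "AE s in M. s \<in> S" using S(2) Ssets by (simp add: prob_eq_1)
  then have "emeasure M {..l} = emeasure M (S \<inter> {..l})"
    using Ssets by (intro emeasure_eq_AE) auto
  also have "\<dots> = (\<integral>\<^sup>+x. emeasure M {x} \<partial>count_space (S \<inter> {..l}))"
    using S(1) by (intro emeasure_countable_singleton) (auto intro: countable_Int1)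
  also have "\<dots> = (\<integral>\<^sup>+x. 0 \<partial>count_space (S \<inter> {..l}))"
  proof (intro nn_integral_cong)
    fix x assume "x \<in> space (count_space (S \<inter> {..l}))"
    then have "\<not> 0 < measure M {x}" using above[of x] by auto
    then show "emeasure M {x} = 0" by (simp add: emeasure_eq_measure zero_less_measure_iff)
  qed
  finally show ?thesis by (simp add: cdf_def measure_def)
qed

text \<open>This is what \<open>beta\<close> depends on: either the level c is attained, or it lies
  strictly between the values of the distribution function at the two thresholds, whose difference
  is then a positive denominator.\<close>

lemma thresholds_cases:
  assumes M: "real_distribution M" and c: "0 < c" "c < 1" and th: "thresholds M c l u"
    and type: "continuous_on UNIV (cdf M) \<or> discrete_distribution M"
  obtains "cdf M l = c" "u = l" | "cdf M l < c" "c < cdf M u" "l < u"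
proof (cases "\<exists>a. cdf M a = c")
  case True
  with th that show ?thesis by (auto simp: thresholds_def)
next
  case False
  interpret real_distribution M by (rule M)
  define below above where "below = {x. 0 < measure M {x} \<and> cdf M x < c}"
    and "above = {x. 0 < measure M {x} \<and> c < cdf M x}"
  have u: "u \<in> above" "\<forall>x\<in>above. u \<le> x" and l: "if below = {} then l < u else l \<in> below"
    using th False by (auto simp: thresholds_def Let_def below_def above_def split: if_splits)
  \<comment> \<open>By the intermediate value theorem a continuous distribution function would
    attain c.\<close>
  have "\<not> continuous_on UNIV (cdf M)"
  proof
    assume cont: "continuous_on UNIV (cdf M)"
    have "eventually (\<lambda>x. cdf M x < c) at_bot"
      using order_tendstoD(2)[OF cdf_lim_at_bot c(1)] .
    then obtain p where p: "cdf M p < c" by (auto simp: eventually_at_bot_linorder)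
    have q: "c < cdf M u" using u by (simp add: above_def)
    then have "p \<le> u" using p cdf_nondecreasing[of u p] by linarith
    moreover have "continuous_on {p..u} (cdf M)" by (rule continuous_on_subset[OF cont]) auto
    ultimately show False using IVT'[of "cdf M" p c u] p q False by auto
  qed
  with type have disc: "discrete_distribution M" by simp
  have "cdf M l < c"
  proof (cases "below = {}")
    case True
    have "l < x" if "0 < measure M {x}" for x
    proof -
      \<comment> \<open>The case assumption excludes an atom at which the distribution function
        equals c, so an atom outside \<open>below\<close> lies in \<open>above\<close>, hence at or
        beyond u.\<close>
      have "x \<in> above" using that True False by (force simp: above_def below_def not_less order_le_less)
      then show ?thesis using u l True by force
    qed
    from cdf_eq_0_if_atoms_above[OF M disc this] c show ?thesis by simp
  next
    case False
    with l have "l \<in> below" by simp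
    then show ?thesis by (simp add: below_def)
  qed
  moreover have "c < cdf M u" using u by (simp add: above_def)
  moreover from calculation have "l < u" using cdf_nondecreasing[of u l] by linarith
  ultimately show ?thesis by (rule that(2))
qed

text \<open>Single and multiple attributes are treated together: the mechanism acts on the data only
  through \<open>code\<close>, and distributions and thresholds are indexed by codes. Beliefs,
  however, concern the data values themselves; finiteness of these and the support of the prior make
  the prior probabilities of one player's data add up to 1.\<close>

locale count_mechanism =
  fixes P :: "'x mechanism"
  assumes privacy_pos: "0 < privacy P"
    and accept_prob: "0 < accept_prob P" "accept_prob P < 1"
    and num_codes_pos: "1 \<le> num_codes P"
    and finite_data: "finite (data_values P)"
    and code: "\<And>x. x \<in> data_values P \<Longrightarrow> code P x \<in> {1..num_codes P}"
    and prior: "set_pmf (prior P) \<subseteq> databases P"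
    and cost_dist: "\<And>j. j \<in> {1..num_codes P} \<Longrightarrow> real_distribution (cost_dist P j)"
    and cost_type: "\<And>j. j \<in> {1..num_codes P} \<Longrightarrow>
      continuous_on UNIV (cdf (cost_dist P j)) \<or> discrete_distribution (cost_dist P j)"
    and thresholds: "\<And>j. j \<in> {1..num_codes P} \<Longrightarrow>
      thresholds (cost_dist P j) (accept_prob P) (thr_lo P j) (thr_hi P j)"
begin

definition codes :: "nat set" where
  "codes = {1..num_codes P}"

abbreviation acceptance :: "bool measure" where
  "acceptance \<equiv> measure_pmf (bernoulli_pmf (accept_prob P))"

abbreviation acceptances :: "(nat \<Rightarrow> bool) measure" where
  "acceptances \<equiv> \<Pi>\<^sub>M i\<in>players P. acceptance"

abbreviation count_noise_law :: "real measure" where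
  "count_noise_law \<equiv> laplace (1 / privacy P)"

abbreviation payment_noise_law :: "real measure" where
  "payment_noise_law \<equiv> laplace (gamma P / privacy P)"

lemma finite_players [simp]: "finite (players P)"
  by (simp add: players_def)

lemma database_code:
  "D \<in> databases P \<Longrightarrow> i \<in> players P \<Longrightarrow> code P (D i) \<in> codes"
  using code by (auto simp: databases_def codes_def)

lemma threshold_cases:
  assumes "j \<in> codes"
  obtains "cdf (cost_dist P j) (thr_lo P j) = accept_prob P" "thr_hi P j = thr_lo P j"
  | "cdf (cost_dist P j) (thr_lo P j) < accept_prob P"
    "accept_prob P < cdf (cost_dist P j) (thr_hi P j)" "thr_lo P j < thr_hi P j"
  using thresholds_cases[OF cost_dist accept_prob thresholds cost_type] assms unfolding codes_def by blast

lemma thr_lo_le_hi: "j \<in> codes \<Longrightarrow> thr_lo P j \<le> thr_hi P j"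
  by (erule threshold_cases) auto

text \<open>Without these bounds \<open>bernoulli_pmf\<close> would clamp its parameter to the unit
  interval and \<open>threshold_law\<close> would have other weights.\<close>

lemma beta_range:
  assumes "j \<in> codes"
  shows "0 \<le> beta P j" "beta P j \<le> 1"
  by (rule threshold_cases[OF assms]; simp add: beta_def divide_simps)+

text \<open>The weight \<open>beta\<close> is the solution of this equation. When the thresholds
  coincide it is 0 / 0, which is 0, and the equation holds because both values of the distribution
  function are already c.\<close>

lemma beta_mean_cdf:
  assumes "j \<in> codes"
  shows "beta P j * cdf (cost_dist P j) (thr_hi P j) +
    (1 - beta P j) * cdf (cost_dist P j) (thr_lo P j) = accept_prob P"
proof (cases rule: threshold_cases[OF assms])
  case 1
  then show ?thesis by (simp add: beta_def)
next
  case 2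
  let ?l = "cdf (cost_dist P j) (thr_lo P j)" and ?u = "cdf (cost_dist P j) (thr_hi P j)"
  have "beta P j * (?u - ?l) = accept_prob P - ?l" using 2 by (simp add: beta_def)
  then show ?thesis by (simp add: algebra_simps)
qed

lemma gamma_bound:
  assumes "j \<in> codes" "a \<in> {thr_lo P j, thr_hi P j}"
    "j' \<in> codes" "a' \<in> {thr_lo P j', thr_hi P j'}"
  shows "\<bar>a - a'\<bar> \<le> gamma P"
proof -
  have "thr_hi P k \<le> Max (thr_hi P ` codes)" "Min (thr_lo P ` codes) \<le> thr_lo P k"
    if "k \<in> codes" for k using that by (auto simp: codes_def)
  from this[OF assms(1)] this[OF assms(3)] thr_lo_le_hi[OF assms(1)] thr_lo_le_hi[OF assms(3)]
  show ?thesis using assms(2,4) unfolding gamma_def codes_def[symmetric] by auto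
qed

lemma gamma_nonneg: "0 \<le> gamma P"
proof -
  have "\<bar>thr_lo P 1 - thr_lo P 1\<bar> \<le> gamma P"
    by (rule gamma_bound[of 1 _ 1]) (use num_codes_pos in \<open>auto simp: codes_def\<close>)
  then show ?thesis by simp
qed

lemma sets_threshold_law [simp, measurable_cong]: "sets (threshold_law P j) = sets borel"
  by (simp add: threshold_law_def)

lemma space_threshold_law [simp]: "space (threshold_law P j) = UNIV"
  by (simp add: threshold_law_def)

lemma prob_space_threshold_law: "prob_space (threshold_law P j)"
  unfolding threshold_law_def by (intro measure_pmf.prob_space_distr) simp

lemma AE_threshold_law: "AE a in threshold_law P j. a \<in> {thr_lo P j, thr_hi P j}"
  unfolding threshold_law_def by (subst AE_distr_iff) auto

lemma real_distribution_cost_dist: "j \<in> codes \<Longrightarrow> real_distribution (cost_dist P j)"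
  using cost_dist by (simp add: codes_def)

lemma nn_integral_threshold_law:
  assumes "j \<in> codes" and [measurable]: "f \<in> borel_measurable borel"
  shows "(\<integral>\<^sup>+a. f a \<partial>threshold_law P j) =
    ennreal (beta P j) * f (thr_hi P j) + ennreal (1 - beta P j) * f (thr_lo P j)"
  using beta_range[OF assms(1)] unfolding threshold_law_def
  by (subst nn_integral_distr) (auto simp: mult.commute)

lemma space_cost_dist [simp]: "j \<in> codes \<Longrightarrow> space (cost_dist P j) = UNIV"
  using real_distribution_cost_dist[of j] real_distribution.space_eq_univ by blast

lemma sets_cost_dist [simp, measurable_cong]: "j \<in> codes \<Longrightarrow> sets (cost_dist P j) = sets borel"
  using real_distribution_cost_dist[of j] real_distribution.events_eq_borel by blast

lemma prob_space_cost_dist: "j \<in> codes \<Longrightarrow> prob_space (cost_dist P j)"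
  using real_distribution_cost_dist[of j] by (simp add: real_distribution_def)

text \<open>E ranges over the four events about one decision. Writing all of them as one affine
  function of the value of the distribution function lets an average over thresholds act on that
  value alone.\<close>

lemma emeasure_cost_dist_le:
  assumes j: "j \<in> codes"
  shows "emeasure (cost_dist P j) {v. (v \<le> a) \<in> E} = ennreal (of_bool (True \<in> E) *
    cdf (cost_dist P j) a + of_bool (False \<in> E) * (1 - cdf (cost_dist P j) a))"
proof -
  interpret real_distribution "cost_dist P j" by (rule real_distribution_cost_dist[OF j])
  have compl: "emeasure (cost_dist P j) (- {..a}) = ennreal (1 - cdf (cost_dist P j) a)"
    using prob_compl[of "{..a}"] by (simp add: emeasure_eq_measure cdf_def Compl_eq_Diff_UNIV)
  have "(v \<le> a) \<in> E \<longleftrightarrow> (if v \<le> a then True \<in> E else False \<in> E)" for v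
    by (cases "v \<le> a") auto
  then have "{v. (v \<le> a) \<in> E} = (if True \<in> E then {..a} else {}) \<union> (if False \<in> E then - {..a} else {})"
    by auto
  moreover have "{..a} \<union> {a<..} = (UNIV :: real set)" by auto
  ultimately show ?thesis
    using emeasure_space_1 compl by (auto simp: emeasure_eq_measure cdf_def simp del: ennreal_plus)
qed

lemma borel_measurable_emeasure_cost_dist_le [measurable]:
  assumes j: "j \<in> codes"
  shows "(\<lambda>a. emeasure (cost_dist P j) {v. (v \<le> a) \<in> E}) \<in> borel_measurable borel"
proof -
  interpret real_distribution "cost_dist P j" by (rule real_distribution_cost_dist[OF j])
  have [measurable]: "cdf (cost_dist P j) \<in> borel_measurable borel"
    by (intro borel_measurable_mono monoI cdf_nondecreasing)
  show ?thesis unfolding emeasure_cost_dist_le[OF j] by measurable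
qed

lemma emeasure_acceptance:
  assumes j: "j \<in> codes"
  shows "(\<integral>\<^sup>+a. emeasure (cost_dist P j) {v. (v \<le> a) \<in> E} \<partial>threshold_law P j) = emeasure acceptance E"
proof -
  interpret real_distribution "cost_dist P j" by (rule real_distribution_cost_dist[OF j])
  let ?b = "beta P j" and ?u = "cdf (cost_dist P j) (thr_hi P j)" and ?l = "cdf (cost_dist P j) (thr_lo P j)"
  let ?g = "\<lambda>p. of_bool (True \<in> E) * p + of_bool (False \<in> E) * (1 - p) :: real"
  have g: "0 \<le> ?g p" if "0 \<le> p" "p \<le> 1" for p using that by simp
  have cdf: "0 \<le> cdf (cost_dist P j) x" "cdf (cost_dist P j) x \<le> 1" for x
    by (auto simp: cdf_def)
  have "(\<integral>\<^sup>+a. emeasure (cost_dist P j) {v. (v \<le> a) \<in> E} \<partial>threshold_law P j) =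
      ennreal ?b * ennreal (?g ?u) + ennreal (1 - ?b) * ennreal (?g ?l)"
    unfolding nn_integral_threshold_law[OF j borel_measurable_emeasure_cost_dist_le[OF j]]
    using j by (simp add: emeasure_cost_dist_le)
  also have "\<dots> = ennreal (?b * ?g ?u + (1 - ?b) * ?g ?l)"
    using beta_range[OF j] g[OF cdf] by (subst ennreal_plus) (simp_all add: ennreal_mult)
  \<comment> \<open>An affine function commutes with averages whose weights add up to 1.\<close>
  also have "?b * ?g ?u + (1 - ?b) * ?g ?l = ?g (?b * ?u + (1 - ?b) * ?l)"
    by (simp add: algebra_simps)
  also have "\<dots> = ?g (accept_prob P)" unfolding beta_mean_cdf[OF j] ..
  also have "ennreal \<dots> = emeasure acceptance E"
  proof -
    have "emeasure acceptance E = (\<integral>\<^sup>+b. indicator E b \<partial>acceptance)" by simp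
    also have "\<dots> = ennreal (?g (accept_prob P))"
      using accept_prob by (subst nn_integral_bernoulli_pmf) (auto simp: indicator_def simp flip: ennreal_plus)
    finally show ?thesis by simp
  qed
  finally show ?thesis .
qed

lemma measurable_cost_le [measurable]:
  assumes j: "j \<in> codes"
  shows "(\<lambda>(v, a). v \<le> a) \<in> measurable (cost_dist P j \<Otimes>\<^sub>M threshold_law P j) (count_space UNIV)"
proof -
  have "(\<lambda>p. fst p \<le> (snd p :: real)) \<in> measurable (borel \<Otimes>\<^sub>M borel) (count_space UNIV)" by measurable
  then show ?thesis
    using j by (simp add: case_prod_beta' cong: sets_pair_measure_cong measurable_cong_sets)
qed

lemma distr_acceptance:
  assumes j: "j \<in> codes"
  shows "distr (cost_dist P j \<Otimes>\<^sub>M threshold_law P j) (count_space UNIV) (\<lambda>(v, a). v \<le> a) = acceptance"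
proof (rule measure_eqI)
  let ?M = "cost_dist P j \<Otimes>\<^sub>M threshold_law P j"
  interpret real_distribution "cost_dist P j" by (rule real_distribution_cost_dist[OF j])
  interpret T: prob_space "threshold_law P j" by (rule prob_space_threshold_law)
  interpret pair_prob_space "cost_dist P j" "threshold_law P j" ..
  fix E
  have set: "(\<lambda>(v, a). v \<le> a) -` E \<inter> space ?M \<in> sets ?M"
    by (rule measurable_sets[OF measurable_cost_le[OF j]]) simp
  have "emeasure (distr ?M (count_space UNIV) (\<lambda>(v, a). v \<le> a)) E =
      emeasure ?M ((\<lambda>(v, a). v \<le> a) -` E \<inter> space ?M)"
    using j by (subst emeasure_distr) auto
  also have "\<dots> = (\<integral>\<^sup>+a. emeasure (cost_dist P j) {v. (v \<le> a) \<in> E} \<partial>threshold_law P j)"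
    using j by (subst emeasure_pair_measure_alt2[OF set]) (simp add: vimage_def space_pair_measure)
  also have "\<dots> = emeasure acceptance E" by (rule emeasure_acceptance[OF j])
  finally show "emeasure (distr ?M (count_space UNIV) (\<lambda>(v, a). v \<le> a)) E = emeasure acceptance E" .
qed simp

lemma action_prob_eq:
  assumes "x \<in> data_values P"
  shows "action_prob P x b = pmf (bernoulli_pmf (accept_prob P)) b"
proof -
  let ?M = "cost_dist P (code P x) \<Otimes>\<^sub>M threshold_law P (code P x)"
  have j: "code P x \<in> codes" using assms code by (simp add: codes_def)
  have "action_prob P x b = measure (distr ?M (count_space UNIV) (\<lambda>(v, a). v \<le> a)) {b}"
    unfolding action_prob_def using j
    by (subst measure_distr) (auto intro!: arg_cong[where f = "measure ?M"])
  also have "\<dots> = pmf (bernoulli_pmf (accept_prob P)) b"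
    unfolding distr_acceptance[OF j] by (simp add: measure_pmf_single)
  finally show ?thesis .
qed

lemma sum_prior_prob:
  assumes i: "i \<in> players P"
  shows "(\<Sum>x\<in>data_values P. prior_prob P i x) = 1"
proof -
  have "prior_prob P i x = pmf (map_pmf (\<lambda>D. D i) (prior P)) x" for x
    by (simp add: prior_prob_def pmf_map vimage_def)
  moreover have "set_pmf (map_pmf (\<lambda>D. D i) (prior P)) \<subseteq> data_values P"
    using prior i by (auto simp: databases_def)
  ultimately show ?thesis using finite_data by (simp add: sum_pmf_eq_1)
qed

text \<open>Rejection has the same probability \<open>1 - c\<close> for all data, so it does not change the belief.\<close>

lemma learns_iff:
  assumes i: "i \<in> players P"
  shows "learns P y i \<longleftrightarrow> y i"
proof -
  have "posterior_prob P i False x = prior_prob P i x" if x: "x \<in> data_values P" for x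
  proof -
    have "(\<Sum>x'\<in>data_values P. prior_prob P i x' * action_prob P x' False) =
        (\<Sum>x'\<in>data_values P. prior_prob P i x') * (1 - accept_prob P)"
      unfolding sum_distrib_right using accept_prob by (intro sum.cong) (auto simp: action_prob_eq)
    then show ?thesis
      using x accept_prob by (simp add: posterior_prob_def sum_prior_prob[OF i] action_prob_eq)
  qed
  then show ?thesis by (cases "y i") (auto simp: learns_def)
qed

lemma utility_eq:
  "i \<in> players P \<Longrightarrow> utility P D v A y w i =
    (if y i then privacy P * (A i (code P (D i)) + w i - v i) else 0)"
  by (simp add: utility_def payment_def learns_iff algebra_simps)

end

section \<open>The laws of the decisions and of the payments\<close>

locale count_mechanism_database = count_mechanism P for P :: "'x mechanism" +
  fixes D
  assumes database: "D \<in> databases P"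
begin

abbreviation costs :: "(nat \<Rightarrow> real) measure" where
  "costs \<equiv> \<Pi>\<^sub>M i\<in>players P. cost_dist P (code P (D i))"

abbreviation contract_law :: "(nat \<Rightarrow> real) measure" where
  "contract_law \<equiv> \<Pi>\<^sub>M j\<in>codes. threshold_law P j"

abbreviation offers :: "(nat \<Rightarrow> nat \<Rightarrow> real) measure" where
  "offers \<equiv> \<Pi>\<^sub>M i\<in>players P. contract_law"

text \<open>The restriction makes the vector a point of the space of \<open>acceptances\<close>,
  whose elements are undefined off the set of players.\<close>

definition decisions :: "(nat \<Rightarrow> real) \<times> (nat \<Rightarrow> nat \<Rightarrow> real) \<Rightarrow> nat \<Rightarrow> bool" where
  "decisions = (\<lambda>(v, A). restrict (truthful P D v A) (players P))"

lemma code_D [simp]: "i \<in> players P \<Longrightarrow> code P (D i) \<in> codes"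
  by (rule database_code[OF database])

lemma noise_scale_nonneg: "0 \<le> gamma P / privacy P"
  using gamma_nonneg privacy_pos by simp

lemma prob_space_costs: "prob_space costs"
  using code_D by (intro prob_space_PiM prob_space_cost_dist)

lemma prob_space_contract_law: "prob_space contract_law"
  by (intro prob_space_PiM prob_space_threshold_law)

lemma prob_space_offers: "prob_space offers"
  by (intro prob_space_PiM prob_space_contract_law)

lemma prob_space_count_noise: "prob_space (laplace (1 / privacy P))"
  using privacy_pos by (intro prob_space_laplace) simp

lemma prob_space_payment_noise: "prob_space (payment_noise P)"
  unfolding payment_noise_def using noise_scale_nonneg by (intro prob_space_PiM prob_space_laplace)

lemma prob_space_acceptances: "prob_space acceptances"
  by (intro prob_space_PiM prob_space_measure_pmf)

lemma randomness_eq: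
  "randomness P D = costs \<Otimes>\<^sub>M offers \<Otimes>\<^sub>M laplace (1 / privacy P) \<Otimes>\<^sub>M payment_noise P"
  by (simp add: randomness_def codes_def)

lemma prob_space_randomness: "prob_space (randomness P D)"
  unfolding randomness_eq
  by (intro prob_space_pair prob_space_costs prob_space_offers prob_space_count_noise prob_space_payment_noise)

lemma measurable_cost [measurable]: "i \<in> players P \<Longrightarrow> (\<lambda>v. v i) \<in> borel_measurable costs"
  using measurable_component_singleton[of i "players P" "\<lambda>i. cost_dist P (code P (D i))"]
  by (simp add: measurable_cong_sets[OF refl sets_cost_dist])

lemma measurable_contract [measurable]: "j \<in> codes \<Longrightarrow> (\<lambda>a. a j) \<in> borel_measurable contract_law"
  using measurable_component_singleton[of j codes "threshold_law P"]
  by (simp add: measurable_cong_sets[OF refl sets_threshold_law])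

lemma measurable_threshold [measurable]:
  assumes "i \<in> players P" "j \<in> codes"
  shows "(\<lambda>A. A i j) \<in> borel_measurable offers"
  using measurable_compose[OF measurable_component_singleton[OF assms(1)] measurable_contract[OF assms(2)]] .

lemma measurable_payment_noise [measurable]:
  "i \<in> players P \<Longrightarrow> (\<lambda>w. w i) \<in> borel_measurable (payment_noise P)"
  using measurable_component_singleton[of i "players P" "\<lambda>i. laplace (gamma P / privacy P)"]
  unfolding payment_noise_def by (subst (asm) measurable_cong_sets[OF refl sets_laplace])

lemma pred_truthful [measurable]:
  assumes "i \<in> players P"
  shows "Measurable.pred (costs \<Otimes>\<^sub>M offers) (\<lambda>p. truthful P D (fst p) (snd p) i)"
proof -
  note [measurable] = measurable_cost[OF assms] measurable_threshold[OF assms code_D[OF assms]]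
  show ?thesis unfolding truthful_def by measurable
qed

lemma measurable_decisions [measurable]: "decisions \<in> measurable (costs \<Otimes>\<^sub>M offers) acceptances"
  unfolding decisions_def case_prod_beta'
  by (intro measurable_restrict) (auto intro: pred_truthful)

text \<open>Boxes identify a product measure. For fixed contracts the independent costs give a
  product with one factor per player, depending on that player's contract only. Contracts of
  different players are independent, so the mean of the product is the product of the means, and
  each mean is the law of a single decision.\<close>

lemma distr_decisions: "distr (costs \<Otimes>\<^sub>M offers) acceptances decisions = acceptances"
proof -
  interpret acc: product_prob_space "\<lambda>_. acceptance" "players P"
    by (intro product_prob_spaceI) (rule prob_space_measure_pmf)
  interpret off: product_prob_space "\<lambda>_. contract_law" "players P"
    by (intro product_prob_spaceI) (rule prob_space_contract_law)
  interpret costs: prob_space costs by (rule prob_space_costs)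
  interpret offers: prob_space offers by (rule prob_space_offers)
  interpret co: pair_prob_space costs offers ..
  show ?thesis
  proof (rule acc.PiM_eqI)
    fix E :: "nat \<Rightarrow> bool set"
    let ?cd = "\<lambda>i. code P (D i)"
    let ?g = "\<lambda>i a. emeasure (cost_dist P (?cd i)) {v. (v \<le> a) \<in> E i}"
    have box: "Pi\<^sub>E (players P) E \<in> sets acceptances" by (intro sets_PiM_I_finite) auto
    have set: "decisions -` Pi\<^sub>E (players P) E \<inter> space (costs \<Otimes>\<^sub>M offers) \<in> sets (costs \<Otimes>\<^sub>M offers)"
      using measurable_sets[OF measurable_decisions box] .
    have slice: "(\<lambda>v. (v, A)) -` (decisions -` Pi\<^sub>E (players P) E \<inter> space (costs \<Otimes>\<^sub>M offers)) =
        (\<Pi>\<^sub>E i\<in>players P. {v. (v \<le> A i (?cd i)) \<in> E i})" if "A \<in> space offers" for A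
      using that code_D
      by (auto simp: decisions_def truthful_def space_pair_measure space_PiM PiE_iff)
    have V: "emeasure costs (\<Pi>\<^sub>E i\<in>players P. {v. (v \<le> A i (?cd i)) \<in> E i}) = (\<Prod>i\<in>players P. ?g i (A i (?cd i)))" for A
    proof -
      \<comment> \<open>A database is unspecified off the players, so there the cost distribution
        need not be a probability measure. The point mass pads the family, because
        \<open>product_prob_space\<close> asks for a probability space at every index.\<close>
      define F where "F i = (if i \<in> players P then cost_dist P (?cd i) else return borel 0)" for i
      interpret F: product_prob_space F "players P"
        by (intro product_prob_spaceI) (auto simp: F_def prob_space_cost_dist prob_space_return)
      have costs: "costs = PiM (players P) F" by (intro PiM_cong) (auto simp: F_def)
      have "{v. (v \<le> A i (?cd i)) \<in> E i} \<in> sets borel" for i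
        by measurable
      then show ?thesis
        unfolding costs using code_D by (subst F.emeasure_PiM) (auto simp: F_def intro!: prod.cong)
    qed
    have "emeasure (distr (costs \<Otimes>\<^sub>M offers) acceptances decisions) (Pi\<^sub>E (players P) E) =
        emeasure (costs \<Otimes>\<^sub>M offers) (decisions -` Pi\<^sub>E (players P) E \<inter> space (costs \<Otimes>\<^sub>M offers))"
      using box by (subst emeasure_distr) auto
    also have "\<dots> = (\<integral>\<^sup>+A. (\<Prod>i\<in>players P. ?g i (A i (?cd i))) \<partial>offers)"
      by (subst co.emeasure_pair_measure_alt2[OF set]) (intro nn_integral_cong, simp only: slice V)
    also have "\<dots> = (\<Prod>i\<in>players P. \<integral>\<^sup>+a. ?g i (a (?cd i)) \<partial>contract_law)"
      by (rule off.product_nn_integral_prod) (auto intro!: measurable_compose[OF measurable_contract borel_measurable_emeasure_cost_dist_le])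
    also have "\<dots> = (\<Prod>i\<in>players P. emeasure acceptance (E i))"
    proof (intro prod.cong refl)
      fix i assume i: "i \<in> players P"
      \<comment> \<open>Only the threshold for the player's actual code matters, so the contract is
        replaced by its marginal at that code.\<close>
      have "(\<integral>\<^sup>+a. ?g i (a (?cd i)) \<partial>contract_law) =
          (\<integral>\<^sup>+a. ?g i a \<partial>distr contract_law (threshold_law P (?cd i)) (\<lambda>a. a (?cd i)))"
        using code_D[OF i] by (subst nn_integral_distr)
          (auto simp: measurable_cong_sets[OF sets_threshold_law refl] intro!: borel_measurable_emeasure_cost_dist_le)
      also have "\<dots> = emeasure acceptance (E i)"
        using code_D[OF i]
        by (subst distr_PiM_component) (auto simp: emeasure_acceptance prob_space_threshold_law)
      finally show "(\<integral>\<^sup>+a. ?g i (a (?cd i)) \<partial>contract_law) = emeasure acceptance (E i)" .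
    qed
    finally show "emeasure (distr (costs \<Otimes>\<^sub>M offers) acceptances decisions) (Pi\<^sub>E (players P) E) =
        (\<Prod>i\<in>players P. emeasure acceptance (E i))" .
  qed auto
qed

lemma distr_decisions_noise:
  "distr (randomness P D) (acceptances \<Otimes>\<^sub>M laplace (1 / privacy P)) (\<lambda>(v, A, z, w). (decisions (v, A), z)) =
    acceptances \<Otimes>\<^sub>M laplace (1 / privacy P)"
  unfolding randomness_eq
  by (rule distr_pair_regroup[OF prob_space_costs prob_space_offers prob_space_count_noise
        prob_space_payment_noise measurable_decisions distr_decisions])

text \<open>The payment of a truthful player is a function of these three coordinates. Their joint
  law is assembled factor by factor, and the count noise is dropped on the way.\<close>

lemma distr_player:
  assumes i: "i \<in> players P"
  defines "j \<equiv> code P (D i)"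
  shows "distr (randomness P D)
    (cost_dist P j \<Otimes>\<^sub>M threshold_law P j \<Otimes>\<^sub>M laplace (gamma P / privacy P))
    (\<lambda>(v, A, z, w). (v i, A i j, w i)) =
    cost_dist P j \<Otimes>\<^sub>M threshold_law P j \<Otimes>\<^sub>M laplace (gamma P / privacy P)"
proof -
  have j: "j \<in> codes" using i by (simp add: j_def)
  let ?L = "laplace (gamma P / privacy P)"
  have L: "prob_space ?L" using noise_scale_nonneg by (rule prob_space_laplace)
  have w: "(\<lambda>w. w i) \<in> measurable (payment_noise P) ?L" using i by measurable
  have dw: "distr (payment_noise P) ?L (\<lambda>w. w i) = ?L"
    unfolding payment_noise_def using L i by (intro distr_PiM_component)
  have zw: "(\<lambda>(z, w). w i) \<in> measurable (laplace (1 / privacy P) \<Otimes>\<^sub>M payment_noise P) ?L" using w by measurable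
  note dzw = distr_snd_comp[OF prob_space_count_noise prob_space_payment_noise w dw]
  have a: "(\<lambda>A. A i j) \<in> measurable offers (threshold_law P j)" using i j by measurable
  have "distr offers (threshold_law P j) (\<lambda>A. A i j) =
      distr (distr offers contract_law (\<lambda>A. A i)) (threshold_law P j) (\<lambda>a. a j)"
    using i j by (subst distr_distr) (auto simp: comp_def)
  also have "distr offers contract_law (\<lambda>A. A i) = contract_law"
    by (rule distr_PiM_component[OF prob_space_contract_law i])
  also have "distr contract_law (threshold_law P j) (\<lambda>a. a j) = threshold_law P j"
    by (rule distr_PiM_component[OF prob_space_threshold_law j])
  finally have da: "distr offers (threshold_law P j) (\<lambda>A. A i j) = threshold_law P j" .
  have v: "(\<lambda>v. v i) \<in> measurable costs (cost_dist P j)" using i by (simp add: j_def)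
  have dv: "distr costs (cost_dist P j) (\<lambda>v. v i) = cost_dist P j"
    unfolding j_def using i by (intro distr_PiM_component prob_space_cost_dist code_D)
  have azw: "(\<lambda>(A, (z, w)). (A i j, w i)) \<in>
      measurable (offers \<Otimes>\<^sub>M laplace (1 / privacy P) \<Otimes>\<^sub>M payment_noise P) (threshold_law P j \<Otimes>\<^sub>M ?L)"
    using a w by measurable
  have dazw: "distr (offers \<Otimes>\<^sub>M laplace (1 / privacy P) \<Otimes>\<^sub>M payment_noise P) (threshold_law P j \<Otimes>\<^sub>M ?L)
      (\<lambda>(A, (z, w)). (A i j, w i)) = threshold_law P j \<Otimes>\<^sub>M ?L"
    using distr_pair_map[OF L a zw da dzw] by (simp add: case_prod_beta')
  show ?thesis
    unfolding randomness_eq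
    using distr_pair_map[OF prob_space_pair[OF prob_space_threshold_law L] v azw dv dazw]
    by (simp add: case_prod_beta')
qed

lemma prob_space_payment_noise_law: "prob_space payment_noise_law"
  using noise_scale_nonneg by (rule prob_space_laplace)

lemma measurable_player:
  assumes i: "i \<in> players P"
  defines "j \<equiv> code P (D i)"
  shows "(\<lambda>(v, A, z, w). (v i, A i j, w i)) \<in> measurable (randomness P D)
    (cost_dist P j \<Otimes>\<^sub>M threshold_law P j \<Otimes>\<^sub>M payment_noise_law)"
proof -
  have j: "j \<in> codes" using i by (simp add: j_def)
  have 1: "(\<lambda>\<omega>. fst \<omega> i) \<in> measurable (randomness P D) (cost_dist P j)"
    unfolding randomness_eq j_def
    by (rule measurable_compose[OF measurable_fst measurable_component_singleton[OF i]])
  have 2: "(\<lambda>\<omega>. fst (snd \<omega>) i j) \<in> measurable (randomness P D) (threshold_law P j)"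
    unfolding randomness_eq
    by (rule measurable_compose[OF _ measurable_component_singleton[OF j]],
        rule measurable_compose[OF _ measurable_component_singleton[OF i]],
        rule measurable_compose[OF measurable_snd measurable_fst])
  have 3: "(\<lambda>\<omega>. snd (snd (snd \<omega>)) i) \<in> measurable (randomness P D) payment_noise_law"
    unfolding randomness_eq payment_noise_def
    by (rule measurable_compose[OF _ measurable_component_singleton[OF i]],
        rule measurable_compose[OF measurable_snd], rule measurable_compose[OF measurable_snd], rule measurable_snd)
  show ?thesis
    using measurable_Pair[OF 1 measurable_Pair[OF 2 3]] by (simp add: case_prod_beta')
qed

lemma measurable_offer:
  assumes i: "i \<in> players P"
  defines "j \<equiv> code P (D i)"
  shows "(\<lambda>(v, A, z, w). (A i j, w i)) \<in> measurable (randomness P D) (threshold_law P j \<Otimes>\<^sub>M payment_noise_law)"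
  using measurable_compose[OF measurable_player[OF i] measurable_snd] by (simp add: j_def case_prod_beta')

lemma measurable_noise:
  assumes i: "i \<in> players P"
  shows "(\<lambda>(v, A, z, w). w i) \<in> measurable (randomness P D) payment_noise_law"
  using measurable_compose[OF measurable_offer[OF i] measurable_snd] by (simp add: case_prod_beta')

lemma distr_offer:
  assumes i: "i \<in> players P"
  defines "j \<equiv> code P (D i)"
  shows "distr (randomness P D) (threshold_law P j \<Otimes>\<^sub>M payment_noise_law) (\<lambda>(v, A, z, w). (A i j, w i)) =
    threshold_law P j \<Otimes>\<^sub>M payment_noise_law"
proof -
  have j: "j \<in> codes" using i by (simp add: j_def)
  let ?N = "threshold_law P j \<Otimes>\<^sub>M payment_noise_law"
  have N: "prob_space ?N"
    by (intro prob_space_pair prob_space_threshold_law prob_space_payment_noise_law)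
  have "distr (randomness P D) ?N (\<lambda>(v, A, z, w). (A i j, w i)) =
      distr (distr (randomness P D) (cost_dist P j \<Otimes>\<^sub>M ?N) (\<lambda>(v, A, z, w). (v i, A i j, w i))) ?N (\<lambda>(x, y). y)"
    using measurable_player[OF i] by (subst distr_distr) (auto simp: comp_def case_prod_beta' j_def)
  also have "\<dots> = ?N"
    unfolding distr_player[OF i, folded j_def]
    by (rule distr_snd_comp[OF prob_space_cost_dist[OF j] N]) (simp_all add: distr_id)
  finally show ?thesis .
qed

section \<open>Expected payments and utilities\<close>

lemma payment_noise_mean:
  assumes i: "i \<in> players P"
  shows "has_bochner_integral (payment_noise P) (\<lambda>w. w i) 0"
proof -
  have "distr (payment_noise P) payment_noise_law (\<lambda>w. w i) = payment_noise_law"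
    unfolding payment_noise_def using prob_space_payment_noise_law i by (intro distr_PiM_component)
  from has_bochner_integral_measure_preserving[OF _ measurable_ident_sets[OF sets_laplace]
      this laplace_mean[OF noise_scale_nonneg]]
  show ?thesis using i by simp
qed

lemma randomness_noise_mean:
  assumes i: "i \<in> players P"
  shows "has_bochner_integral (randomness P D) (\<lambda>(v, A, z, w). w i) 0"
proof -
  define j where "j = code P (D i)"
  have j: "j \<in> codes" using i by (simp add: j_def)
  let ?N = "threshold_law P j \<Otimes>\<^sub>M payment_noise_law"
  have m: "(\<lambda>(v, A, z, w). (A i j, w i)) \<in> measurable (randomness P D) ?N"
    using measurable_offer[OF i] by (simp add: j_def)
  have "distr ?N payment_noise_law (\<lambda>(x, y). y) = payment_noise_law"
    by (rule distr_snd_comp[OF prob_space_threshold_law prob_space_payment_noise_law]) (simp_all add: distr_id)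
  moreover have "distr (randomness P D) payment_noise_law (\<lambda>(v, A, z, w). w i) =
      distr (distr (randomness P D) ?N (\<lambda>(v, A, z, w). (A i j, w i))) payment_noise_law (\<lambda>(x, y). y)"
    using m by (subst distr_distr) (auto simp: comp_def case_prod_beta')
  ultimately have "distr (randomness P D) payment_noise_law (\<lambda>(v, A, z, w). w i) = payment_noise_law"
    unfolding distr_offer[OF i, folded j_def] by simp
  from has_bochner_integral_measure_preserving[OF measurable_noise[OF i]
      measurable_ident_sets[OF sets_laplace] this laplace_mean[OF noise_scale_nonneg]]
  show ?thesis by (simp add: case_prod_beta')
qed

text \<open>The actions of the others do not enter the utility of player i. His cost and contract
  are fixed by the overwriting, so only the centred payment noise remains random.\<close>

lemma deviation_utility_mean:
  assumes i: "i \<in> players P"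
  shows "has_bochner_integral (randomness P D) (deviation_utility P D i t a b)
    (if b then privacy P * (a (code P (D i)) - t) else 0)"
proof -
  interpret prob_space "randomness P D" by (rule prob_space_randomness)
  let ?s = "a (code P (D i)) - t"
  have eq: "deviation_utility P D i t a b =
      (\<lambda>(v, A, z, w). if b then privacy P * (?s + w i) else 0)"
    using i by (intro ext) (simp add: deviation_utility_def utility_eq Let_def case_prod_beta')
  have "has_bochner_integral (randomness P D) (\<lambda>x. privacy P * (?s + (case x of (v, A, z, w) \<Rightarrow> w i)))
      (privacy P * (?s + 0))"
    by (intro has_bochner_integral_mult_right has_bochner_integral_add randomness_noise_mean[OF i])
      (simp add: has_bochner_integral_iff prob_space)
  then show ?thesis
    unfolding eq by (cases b) (auto simp: case_prod_beta' has_bochner_integral_zero)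
qed

text \<open>Here the contract is random as well. Averaging over the noise first leaves, for each
  threshold a, the value \<open>privacy P * (a - t)\<close> if t <= a and 0 otherwise, which is
  nonnegative before any averaging over a. Fubini's theorem needs the integrability of f, which
  comes from the bound by absolute values.\<close>

lemma truthful_utility_nonneg:
  assumes i: "i \<in> players P"
  shows "integrable (randomness P D) (truthful_utility P D i t)"
    "0 \<le> (\<integral>\<omega>. truthful_utility P D i t \<omega> \<partial>randomness P D)"
proof -
  define j where "j = code P (D i)"
  have j: "j \<in> codes" using i by (simp add: j_def)
  interpret T: prob_space "threshold_law P j" by (rule prob_space_threshold_law)
  interpret L: prob_space payment_noise_law by (rule prob_space_payment_noise_law)
  interpret N: pair_prob_space "threshold_law P j" payment_noise_law ..
  let ?N = "threshold_law P j \<Otimes>\<^sub>M payment_noise_law"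
  define f where "f = (\<lambda>(a, w). if t \<le> a then privacy P * (a + w - t) else (0 :: real))"
  have f [measurable]: "f \<in> borel_measurable ?N" unfolding f_def by measurable
  have m: "(\<lambda>(v, A, z, w). (A i j, w i)) \<in> measurable (randomness P D) ?N"
    using measurable_offer[OF i] by (simp add: j_def)
  have eq: "truthful_utility P D i t = (\<lambda>\<omega>. f (case \<omega> of (v, A, z, w) \<Rightarrow> (A i j, w i)))"
    using i by (intro ext) (simp add: truthful_utility_def utility_eq Let_def f_def truthful_def j_def case_prod_beta')
  have w: "integrable ?N snd"
  proof -
    have "distr ?N payment_noise_law (\<lambda>(x, y). y) = payment_noise_law"
      by (rule distr_snd_comp[OF prob_space_threshold_law prob_space_payment_noise_law]) (simp_all add: distr_id)
    moreover have "integrable payment_noise_law (\<lambda>x. x)"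
      using laplace_mean[OF noise_scale_nonneg] by (simp add: has_bochner_integral_iff)
    ultimately have "integrable (distr ?N payment_noise_law (\<lambda>(x, y). y)) (\<lambda>x. x)" by simp
    then show ?thesis
      by (subst (asm) integrable_distr_eq) (auto simp: case_prod_beta' measurable_ident_sets[OF sets_laplace])
  qed
  have a: "integrable ?N fst"
  proof -
    have "integrable (threshold_law P j) (\<lambda>x. x)"
      unfolding threshold_law_def
      by (subst integrable_distr_eq) (auto intro: integrable_measure_pmf_finite)
    then have "integrable (distr ?N (threshold_law P j) fst) (\<lambda>x. x)" by (simp add: L.distr_pair_fst)
    then show ?thesis
      by (subst (asm) integrable_distr_eq) (auto simp: measurable_ident_sets[OF sets_threshold_law])
  qed
  have int: "integrable ?N f"
  proof (rule Bochner_Integration.integrable_bound[OF _ f])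
    show "integrable ?N (\<lambda>x. privacy P * (\<bar>fst x\<bar> + \<bar>snd x\<bar> + \<bar>t\<bar>))"
      using a w by (intro integrable_mult_right Bochner_Integration.integrable_add integrable_abs) auto
    show "AE x in ?N. norm (f x) \<le> norm (privacy P * (\<bar>fst x\<bar> + \<bar>snd x\<bar> + \<bar>t\<bar>))"
      using privacy_pos by (intro AE_I2) (auto simp: f_def abs_mult case_prod_beta')
  qed
  have int_w: "integrable payment_noise_law (\<lambda>w. w)" "(\<integral>w. w \<partial>payment_noise_law) = 0"
    using laplace_mean[OF noise_scale_nonneg] by (auto simp: has_bochner_integral_iff)
  have "(\<integral>x. f x \<partial>?N) = (\<integral>a. \<integral>w. f (a, w) \<partial>payment_noise_law \<partial>threshold_law P j)"
    by (rule N.integral_fst'[OF int, symmetric])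
  also have "\<dots> = (\<integral>a. (if t \<le> a then privacy P * (a - t) else 0) \<partial>threshold_law P j)"
    using int_w L.prob_space by (intro Bochner_Integration.integral_cong) (auto simp: f_def)
  also have "\<dots> \<ge> 0"
    using privacy_pos by (intro Bochner_Integration.integral_nonneg) auto
  finally have nonneg: "0 \<le> (\<integral>x. f x \<partial>?N)" .
  show "integrable (randomness P D) (truthful_utility P D i t)"
    unfolding eq using int distr_offer[OF i, folded j_def] integrable_distr_eq[OF m f] by simp
  show "0 \<le> (\<integral>\<omega>. truthful_utility P D i t \<omega> \<partial>randomness P D)"
    unfolding eq using nonneg distr_offer[OF i, folded j_def] integral_distr[OF m f] by simp
qed

lemma truthful_payment_mean:
  assumes i: "i \<in> players P" and y: "y i"
  shows "has_bochner_integral (payment_noise P) (\<lambda>w. payment P D A y w i)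
    (privacy P * A i (code P (D i)))"
proof -
  interpret prob_space "payment_noise P" by (rule prob_space_payment_noise)
  have "has_bochner_integral (payment_noise P) (\<lambda>w. privacy P * (A i (code P (D i)) + w i))
      (privacy P * (A i (code P (D i)) + 0))"
    by (intro has_bochner_integral_mult_right has_bochner_integral_add payment_noise_mean[OF i])
      (simp add: has_bochner_integral_iff prob_space)
  then show ?thesis using y by (simp add: payment_def)
qed

text \<open>Acceptance and the amount paid both involve the threshold, so the integrals over cost
  and threshold are kept and only the noise is integrated out. A rejecting player is paid exactly 0,
  whence the term \<open>indicator I 0\<close>.\<close>

lemma payment_prob:
  fixes l I
  assumes l: "l \<in> players P" and I [measurable]: "I \<in> sets borel"
  defines "j \<equiv> code P (D l)"
  shows "ennreal (\<P>((v, A, z, w) in randomness P D. payment P D A (truthful P D v A) w l \<in> I)) =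
    (\<integral>\<^sup>+v. \<integral>\<^sup>+a. (if v \<le> a then emeasure payment_noise_law {w. privacy P * (a + w) \<in> I} else indicator I 0)
      \<partial>threshold_law P j \<partial>cost_dist P j)"
proof -
  have j: "j \<in> codes" using l by (simp add: j_def)
  interpret F: prob_space "cost_dist P j" by (rule prob_space_cost_dist[OF j])
  interpret T: prob_space "threshold_law P j" by (rule prob_space_threshold_law)
  interpret L: prob_space payment_noise_law by (rule prob_space_payment_noise_law)
  interpret TL: pair_prob_space "threshold_law P j" payment_noise_law ..
  let ?N = "cost_dist P j \<Otimes>\<^sub>M threshold_law P j \<Otimes>\<^sub>M payment_noise_law"
  let ?X = "\<lambda>(v, A, z, w). (v l, A l j, w l)"
  define S where "S = {(v, a, w). (if v \<le> a then privacy P * (a + w) else (0 :: real)) \<in> I}"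
  have X: "?X \<in> measurable (randomness P D) ?N"
    using measurable_player[OF l] by (simp add: j_def)
  have "{p \<in> space (borel \<Otimes>\<^sub>M borel \<Otimes>\<^sub>M borel). (if fst p \<le> fst (snd p) then privacy P * (fst (snd p) + snd (snd p)) else (0 :: real)) \<in> I}
      \<in> sets (borel \<Otimes>\<^sub>M borel \<Otimes>\<^sub>M borel)" by measurable
  then have S: "S \<in> sets ?N"
    using j by (simp add: S_def space_pair_measure case_prod_beta' cong: sets_pair_measure_cong)
  interpret FTL: pair_prob_space "cost_dist P j" "threshold_law P j \<Otimes>\<^sub>M payment_noise_law" ..
  have "\<P>((v, A, z, w) in randomness P D. payment P D A (truthful P D v A) w l \<in> I) =
      measure (distr (randomness P D) ?N ?X) S"
    by (subst measure_distr[OF X S])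
      (auto intro!: arg_cong[where f = "measure (randomness P D)"] simp: S_def payment_def truthful_def j_def)
  then have "ennreal (\<P>((v, A, z, w) in randomness P D. payment P D A (truthful P D v A) w l \<in> I)) = emeasure ?N S"
    unfolding distr_player[OF l, folded j_def] by (simp add: FTL.emeasure_eq_measure)
  also have "\<dots> = (\<integral>\<^sup>+v. emeasure (threshold_law P j \<Otimes>\<^sub>M payment_noise_law) (Pair v -` S) \<partial>cost_dist P j)"
    by (rule TL.emeasure_pair_measure_alt[OF S])
  also have "\<dots> = (\<integral>\<^sup>+v. \<integral>\<^sup>+a. emeasure payment_noise_law (Pair a -` Pair v -` S) \<partial>threshold_law P j \<partial>cost_dist P j)"
    using sets_Pair1[OF S] by (intro nn_integral_cong L.emeasure_pair_measure_alt)
  also have "\<dots> = (\<integral>\<^sup>+v. \<integral>\<^sup>+a. (if v \<le> a then emeasure payment_noise_law {w. privacy P * (a + w) \<in> I} else indicator I 0)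
      \<partial>threshold_law P j \<partial>cost_dist P j)"
    using L.emeasure_space_1
    by (intro nn_integral_cong) (auto simp: S_def vimage_def indicator_def)
  finally show ?thesis .
qed

text \<open>Evaluates the integrals of \<open>payment_prob\<close> once the integrand has been
  replaced by bounds x and y that are free of the threshold: then only the decision matters, and the
  code disappears from the result.\<close>

lemma nn_integral_accept:
  assumes j: "j \<in> codes"
  shows "(\<integral>\<^sup>+v. \<integral>\<^sup>+a. (if v \<le> a then x else y) \<partial>threshold_law P j \<partial>cost_dist P j) =
    x * accept_prob P + y * (1 - accept_prob P)"
proof -
  interpret T: prob_space "threshold_law P j" by (rule prob_space_threshold_law)
  let ?M = "cost_dist P j \<Otimes>\<^sub>M threshold_law P j"
  note [measurable] = measurable_cost_le[OF j]
  have "(\<integral>\<^sup>+v. \<integral>\<^sup>+a. (if v \<le> a then x else y) \<partial>threshold_law P j \<partial>cost_dist P j) =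
      (\<integral>\<^sup>+p. (if (\<lambda>(v, a). v \<le> a) p then x else y) \<partial>?M)"
    using measurable_compose[OF measurable_cost_le[OF j], of "\<lambda>b. if b then x else y" borel]
    by (subst T.nn_integral_fst[symmetric]) auto
  also have "\<dots> = (\<integral>\<^sup>+b. (if b then x else y) \<partial>distr ?M (count_space UNIV) (\<lambda>(v, a). v \<le> a))"
    by (subst nn_integral_distr) auto
  also have "\<dots> = x * accept_prob P + y * (1 - accept_prob P)"
    unfolding distr_acceptance[OF j] using accept_prob by simp
  finally show ?thesis .
qed

end

section \<open>Incentives and privacy\<close>

context count_mechanism
begin

lemma count_mechanism_database: "D \<in> databases P \<Longrightarrow> count_mechanism_database P D"
  by (intro count_mechanism_database.intro count_mechanism_database_axioms.intro) unfold_locales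

text \<open>Accepting has a mean utility with the sign of threshold minus cost, and rejecting yields
  0, so the truthful rule attains the maximum of the two.\<close>

lemma incentive_compatible: "bayesian_incentive_compatible P"
  unfolding bayesian_incentive_compatible_def
proof (intro ballI allI)
  fix D i t a b
  assume D: "D \<in> databases P" and i: "i \<in> players P"
  interpret count_mechanism_database P D using D by (rule count_mechanism_database)
  note mean = deviation_utility_mean[OF i, unfolded has_bochner_integral_iff]
  show "integrable (randomness P D) (deviation_utility P D i t a b) \<and>
      (\<integral>\<omega>. deviation_utility P D i t a b \<omega> \<partial>randomness P D)
        \<le> (\<integral>\<omega>. deviation_utility P D i t a (t \<le> a (code P (D i))) \<omega> \<partial>randomness P D)"
    using mean[of t a b] mean[of t a "t \<le> a (code P (D i))"] privacy_pos
    by (auto simp: mult_nonneg_nonpos)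
qed

lemma individually_rational: "ex_interim_individually_rational P"
  unfolding ex_interim_individually_rational_def
proof (intro ballI allI)
  fix D i t
  assume D: "D \<in> databases P" and i: "i \<in> players P"
  interpret count_mechanism_database P D using D by (rule count_mechanism_database)
  show "integrable (randomness P D) (truthful_utility P D i t) \<and>
      0 \<le> (\<integral>\<omega>. truthful_utility P D i t \<omega> \<partial>randomness P D)"
    using truthful_utility_nonneg[OF i] by blast
qed

lemma data_private: "perfectly_data_private P"
  unfolding perfectly_data_private_def Let_def
proof (intro ballI allI impI)
  fix D v A i
  assume D: "D \<in> databases P" and i: "i \<in> players P" and learns: "learns P (truthful P D v A) i"
  interpret count_mechanism_database P D using D by (rule count_mechanism_database)
  have "truthful P D v A i" using learns by (simp add: learns_iff[OF i])
  with truthful_payment_mean[where y = "truthful P D v A" and A = A, OF i this] privacy_pos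
  show "integrable (payment_noise P) (\<lambda>w. payment P D A (truthful P D v A) w i) \<and>
      privacy P * v i \<le> (\<integral>w. payment P D A (truthful P D v A) w i \<partial>payment_noise P)"
    by (simp add: has_bochner_integral_iff truthful_def)
qed

section \<open>Differential privacy of the payments\<close>

definition offered :: "real set" where
  "offered = thr_lo P ` codes \<union> thr_hi P ` codes"

text \<open>The probability that the payment falls in I, given acceptance at threshold a. It is the
  same for all players and all data.\<close>

definition payment_kernel :: "real set \<Rightarrow> real \<Rightarrow> real" where
  "payment_kernel I a = measure (laplace (gamma P / privacy P)) {w. privacy P * (a + w) \<in> I}"

lemma payment_kernel_le:
  assumes "a \<in> offered" "a' \<in> offered" and [measurable]: "I \<in> sets borel"
  shows "payment_kernel I a \<le> exp (privacy P) * payment_kernel I a'"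
proof -
  have "\<bar>a - a'\<bar> \<le> gamma P"
    using assms(1,2) gamma_bound unfolding offered_def by blast
  moreover have "{x. privacy P * x \<in> I} \<in> sets borel" by measurable
  ultimately show ?thesis
    using laplace_shift[of "gamma P / privacy P" "privacy P" a a' "{x. privacy P * x \<in> I}"]
      gamma_nonneg privacy_pos by (simp add: payment_kernel_def)
qed

text \<open>Over all thresholds on offer the kernel stays between its minimum k and
  \<open>exp (privacy P) * k\<close>. With B the indicator that 0 is in I, every database therefore
  gives a probability between B (1 - c) + k c and B (1 - c) + exp (eps) k c, and the upper bound is
  at most exp (eps) times the lower one. The databases need not be neighbours for this.\<close>

lemma payment_private:
  assumes D: "D \<in> databases P" and D': "D' \<in> databases P" and l: "l \<in> players P" and I: "I \<in> sets borel"
  shows "\<P>((v, A, z, w) in randomness P D. payment P D A (truthful P D v A) w l \<in> I)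
    \<le> exp (privacy P) * \<P>((v, A, z, w) in randomness P D'. payment P D' A (truthful P D' v A) w l \<in> I)"
proof -
  let ?K = "payment_kernel I" and ?B = "indicator I 0 :: real" and ?e = "exp (privacy P)"
  have off: "finite offered" "offered \<noteq> {}"
    using num_codes_pos by (auto simp: offered_def codes_def)
  \<comment> \<open>The minimum runs over the thresholds of all codes, since player l may have
    different data in the two databases.\<close>
  define k where "k = Min (?K ` offered)"
  have "k \<in> ?K ` offered" unfolding k_def using off by (intro Min_in) auto
  then obtain a0 where a0: "a0 \<in> offered" "k = ?K a0" by blast
  have k_le: "k \<le> ?K a" if "a \<in> offered" for a
    unfolding k_def using off that by (intro Min_le) auto
  have le_k: "?K a \<le> ?e * k" if "a \<in> offered" for a
    unfolding a0(2) using that a0(1) I by (rule payment_kernel_le)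
  have k0: "0 \<le> k" unfolding a0(2) payment_kernel_def by simp
  define p where "p D = \<P>((v, A, z, w) in randomness P D. payment P D A (truthful P D v A) w l \<in> I)" for D
  have bounds: "?B * (1 - accept_prob P) + k * accept_prob P \<le> p D"
    "p D \<le> ?B * (1 - accept_prob P) + (?e * k) * accept_prob P" if D: "D \<in> databases P" for D
  proof -
    interpret count_mechanism_database P D using D by (rule count_mechanism_database)
    define j where "j = code P (D l)"
    have j: "j \<in> codes" using l by (simp add: j_def)
    interpret L: prob_space payment_noise_law by (rule prob_space_payment_noise_law)
    let ?q = "\<lambda>v a. if v \<le> a then ennreal (?K a) else ennreal ?B"
    have "ennreal (p D) = (\<integral>\<^sup>+v. \<integral>\<^sup>+a. ?q v a \<partial>threshold_law P j \<partial>cost_dist P j)"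
      using payment_prob[OF l I, folded j_def]
      unfolding p_def payment_kernel_def L.emeasure_eq_measure ennreal_indicator .
    moreover have AE: "AE a in threshold_law P j. a \<in> offered"
      using AE_threshold_law[of j] by eventually_elim (use j in \<open>auto simp: offered_def\<close>)
    have "(\<integral>\<^sup>+v. \<integral>\<^sup>+a. ?q v a \<partial>threshold_law P j \<partial>cost_dist P j) \<le>
        (\<integral>\<^sup>+v. \<integral>\<^sup>+a. (if v \<le> a then ennreal (?e * k) else ennreal ?B) \<partial>threshold_law P j \<partial>cost_dist P j)"
      using AE by (intro nn_integral_mono nn_integral_mono_AE) (auto elim!: eventually_mono intro!: ennreal_leI le_k)
    moreover have "(\<integral>\<^sup>+v. \<integral>\<^sup>+a. (if v \<le> a then ennreal k else ennreal ?B) \<partial>threshold_law P j \<partial>cost_dist P j) \<le>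
        (\<integral>\<^sup>+v. \<integral>\<^sup>+a. ?q v a \<partial>threshold_law P j \<partial>cost_dist P j)"
      using AE by (intro nn_integral_mono nn_integral_mono_AE) (auto elim!: eventually_mono intro!: ennreal_leI k_le)
    ultimately have "ennreal (k * accept_prob P + ?B * (1 - accept_prob P)) \<le> ennreal (p D)"
      "ennreal (p D) \<le> ennreal ((?e * k) * accept_prob P + ?B * (1 - accept_prob P))"
      using accept_prob k0 by (simp_all only: nn_integral_accept[OF j]) (simp_all add: ennreal_mult ennreal_plus)
    then show "?B * (1 - accept_prob P) + k * accept_prob P \<le> p D"
      "p D \<le> ?B * (1 - accept_prob P) + (?e * k) * accept_prob P"
      using accept_prob k0 by (simp_all add: ennreal_le_iff p_def del: ennreal_plus)
  qed
  have "1 \<le> ?e" using privacy_pos by simp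
  \<comment> \<open>The contribution of rejection is identical on both sides, so the factor, being
    at least 1, only helps there.\<close>
  then have "?B * (1 - accept_prob P) \<le> ?e * (?B * (1 - accept_prob P))"
    using accept_prob mult_right_mono[of 1 ?e "?B * (1 - accept_prob P)"] by simp
  then have "p D \<le> ?e * (?B * (1 - accept_prob P) + k * accept_prob P)"
    using bounds(2)[OF D] by (simp add: algebra_simps)
  also have "\<dots> \<le> ?e * p D'" using bounds(1)[OF D'] by simp
  finally show ?thesis by (simp add: p_def)
qed

section \<open>Differential privacy of the estimate\<close>

lemma estimate_eq:
  "estimate P D y z = max 0 (min (real (num_players P))
    ((real (card {i \<in> players P. y i \<and> code P (D i) = target P}) + z) / accept_prob P))"
  by (simp add: estimate_def Let_def max_def min_def)

lemma estimate_restrict: "estimate P D (restrict y (players P)) z = estimate P D y z"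
proof -
  have "{i \<in> players P. restrict y (players P) i \<and> code P (D i) = target P} =
      {i \<in> players P. y i \<and> code P (D i) = target P}" by auto
  then show ?thesis by (simp add: estimate_eq)
qed

text \<open>As a finite sum over the players, the count is visibly measurable in the
  decisions.\<close>

lemma real_card_accepting:
  "real (card {i \<in> players P. y i \<and> code P (D i) = target P}) =
    (\<Sum>i\<in>players P. if y i then of_bool (code P (D i) = target P) else 0)"
  by (simp add: sum.inter_filter[symmetric] of_bool_def if_bool_eq_conj flip: sum.inter_filter)

lemma pred_acceptances [measurable]: "i \<in> players P \<Longrightarrow> Measurable.pred acceptances (\<lambda>y. y i)"
  using measurable_component_singleton[of i "players P" "\<lambda>_. acceptance"]
  by (simp cong: measurable_cong_sets)

lemma measurable_estimate [measurable]:
  "(\<lambda>p. estimate P D (fst p) (snd p)) \<in> borel_measurable (acceptances \<Otimes>\<^sub>M count_noise_law)"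
  unfolding estimate_eq real_card_accepting by measurable

text \<open>On the right the database occurs only inside \<open>estimate\<close>, no longer in the
  measure. This replaces the coupling of two databases.\<close>

lemma estimate_prob:
  assumes D: "D \<in> databases P" and [measurable]: "Measurable.pred borel Q"
  shows "ennreal (\<P>((v, A, z, w) in randomness P D. Q (estimate P D (truthful P D v A) z))) =
    (\<integral>\<^sup>+y. emeasure count_noise_law {z. Q (estimate P D y z)} \<partial>acceptances)"
proof -
  interpret count_mechanism_database P D using D by (rule count_mechanism_database)
  let ?N = "acceptances \<Otimes>\<^sub>M count_noise_law"
  let ?X = "\<lambda>(v, A, z, w). (decisions (v, A), z)"
  interpret Y: prob_space acceptances by (rule prob_space_acceptances)
  interpret Z: prob_space count_noise_law by (rule prob_space_count_noise)
  interpret N: pair_prob_space acceptances count_noise_law ..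
  have X: "?X \<in> measurable (randomness P D) ?N" unfolding randomness_eq by measurable
  define S where "S = {p \<in> space ?N. Q (estimate P D (fst p) (snd p))}"
  have S: "S \<in> sets ?N" unfolding S_def by measurable
  have "\<P>((v, A, z, w) in randomness P D. Q (estimate P D (truthful P D v A) z)) =
      measure (distr (randomness P D) ?N ?X) S"
    using measurable_space[OF X]
    by (subst measure_distr[OF X S])
      (auto intro!: arg_cong[where f = "measure (randomness P D)"] simp: S_def decisions_def estimate_restrict)
  then have "ennreal (\<P>((v, A, z, w) in randomness P D. Q (estimate P D (truthful P D v A) z))) = emeasure ?N S"
    unfolding distr_decisions_noise by (simp add: N.emeasure_eq_measure)
  also have "\<dots> = (\<integral>\<^sup>+y. emeasure count_noise_law (Pair y -` S) \<partial>acceptances)"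
    by (rule Z.emeasure_pair_measure_alt[OF S])
  also have "\<dots> = (\<integral>\<^sup>+y. emeasure count_noise_law {z. Q (estimate P D y z)} \<partial>acceptances)"
    by (intro nn_integral_cong arg_cong[where f = "emeasure count_noise_law"])
      (auto simp: S_def space_pair_measure)
  finally show ?thesis .
qed

text \<open>At equal decisions only the changed player can enter or leave the count. To this
  sensitivity of 1 the noise scale 1 / eps is matched.\<close>

lemma card_accepting_diff:
  assumes "\<exists>!i. i \<in> players P \<and> D i \<noteq> D' i"
  shows "\<bar>real (card {i \<in> players P. y i \<and> code P (D i) = target P}) -
    real (card {i \<in> players P. y i \<and> code P (D' i) = target P})\<bar> \<le> 1"
proof -
  obtain k where k: "k \<in> players P" "\<And>i. i \<in> players P \<Longrightarrow> i \<noteq> k \<Longrightarrow> D i = D' i"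
    using assms by blast
  have "card {i \<in> players P. y i \<and> code P (D i) = target P} \<le>
      card (insert k {i \<in> players P. y i \<and> code P (D' i) = target P})"
    "card {i \<in> players P. y i \<and> code P (D' i) = target P} \<le>
      card (insert k {i \<in> players P. y i \<and> code P (D i) = target P})"
    using k by (auto intro!: card_mono)
  moreover have "card (insert k B) \<le> Suc (card B)" for B by (cases "finite B") (auto simp: card_insert_if)
  ultimately show ?thesis by (smt (verit) Suc_leI le_trans of_nat_Suc of_nat_mono)
qed

lemma estimate_private:
  assumes D: "D \<in> databases P" and D': "D' \<in> databases P" and diff: "\<exists>!i. i \<in> players P \<and> D i \<noteq> D' i"
    and I [measurable]: "I \<in> sets borel"
  shows "\<P>((v, A, z, w) in randomness P D. estimate P D (truthful P D v A) z \<in> I)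
    \<le> exp (privacy P) * \<P>((v, A, z, w) in randomness P D'. estimate P D' (truthful P D' v A) z \<in> I)"
    (is "?p \<le> _ * ?p'")
proof -
  interpret count_mechanism_database P D using D by (rule count_mechanism_database)
  interpret Z: prob_space count_noise_law by (rule prob_space_count_noise)
  let ?e = "exp (privacy P)"
  have le: "emeasure count_noise_law {z. estimate P D y z \<in> I} \<le>
      ennreal ?e * emeasure count_noise_law {z. estimate P D' y z \<in> I}" for y
  proof -
    \<comment> \<open>J pulls I back through the division by c and the truncation. Both are
      post-processing, so only the noisy count has to be compared.\<close>
    define J where "J = {x. max 0 (min (real (num_players P)) (x / accept_prob P)) \<in> I}"
    have J: "J \<in> sets borel" unfolding J_def by measurable
    have "measure count_noise_law {z. estimate P D y z \<in> I} \<le>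
        ?e * measure count_noise_law {z. estimate P D' y z \<in> I}"
      using laplace_shift[where b = "1 / privacy P" and e = "privacy P", OF _ _ _ J] card_accepting_diff[OF diff, of y]
        privacy_pos by (simp add: estimate_eq J_def)
    then show ?thesis by (simp add: Z.emeasure_eq_measure ennreal_mult'[symmetric])
  qed
  have "ennreal ?p \<le> (\<integral>\<^sup>+y. ennreal ?e * emeasure count_noise_law {z. estimate P D' y z \<in> I} \<partial>acceptances)"
    using I le by (subst estimate_prob[OF D]) (auto intro!: nn_integral_mono)
  also have "\<dots> = ennreal ?e * (\<integral>\<^sup>+y. emeasure count_noise_law {z. estimate P D' y z \<in> I} \<partial>acceptances)"
  proof (rule nn_integral_cmult)
    have "{p \<in> space (acceptances \<Otimes>\<^sub>M count_noise_law). estimate P D' (fst p) (snd p) \<in> I} \<in>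
        sets (acceptances \<Otimes>\<^sub>M count_noise_law)" by measurable
    from Z.measurable_emeasure_Pair[OF this]
    show "(\<lambda>y. emeasure count_noise_law {z. estimate P D' y z \<in> I}) \<in> borel_measurable acceptances"
      by (rule measurable_cong[THEN iffD1, rotated])
        (auto intro!: arg_cong[where f = "emeasure count_noise_law"] simp: space_pair_measure)
  qed
  also have "\<dots> = ennreal ?e * ennreal ?p'"
    using I by (subst estimate_prob[OF D']) auto
  finally show ?thesis by (simp add: ennreal_mult'[symmetric])
qed

lemma mechanism_private: "differentially_private P (privacy P)"
  unfolding differentially_private_def using estimate_private payment_private by blast

section \<open>Accuracy\<close>

lemma card_players [simp]: "card (players P) = num_players P"
  by (simp add: players_def)

lemma acceptance_cross_moment:
  assumes i: "i \<in> players P" and j: "j \<in> players P"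
  defines "X \<equiv> \<lambda>b. of_bool b - accept_prob P"
  shows "has_bochner_integral acceptances (\<lambda>y. X (y i) * X (y j))
    (if i = j then accept_prob P * (1 - accept_prob P) else 0)"
proof -
  interpret product_prob_space "\<lambda>_. acceptance" "players P"
    by (intro product_prob_spaceI) (rule prob_space_measure_pmf)
  \<comment> \<open>Writes the product of two centred decisions as a product over all players,
    trivial except at i and j, so that the integral factorises. For i = j the factor at i is a
    square, whose mean is the variance; otherwise the factor at i has mean 0.\<close>
  define g where "g k b = (if k = i then X b else 1) * (if k = j then X b else 1)" for k b
  have int: "integrable acceptance f" for f :: "bool \<Rightarrow> real"
    by (intro integrable_measure_pmf_finite) simp
  have prod: "(\<Prod>k\<in>players P. g k (y k)) = X (y i) * X (y j)" for y
    using i j by (simp add: g_def prod.distrib)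
  have "integrable acceptances (\<lambda>y. \<Prod>k\<in>players P. g k (y k))"
    by (rule product_integrable_prod) (auto intro: int)
  moreover have "(\<integral>y. (\<Prod>k\<in>players P. g k (y k)) \<partial>acceptances) = (\<Prod>k\<in>players P. \<integral>b. g k b \<partial>acceptance)"
    by (rule product_integral_prod) (auto intro: int)
  moreover have "(\<Prod>k\<in>players P. \<integral>b. g k b \<partial>acceptance) =
      (if i = j then accept_prob P * (1 - accept_prob P) else 0)"
  proof (cases "i = j")
    case True
    have "(\<integral>b. g k b \<partial>acceptance) = (if k = i then accept_prob P * (1 - accept_prob P) else 1)" for k
      using True accept_prob by (simp add: g_def X_def algebra_simps)
    then show ?thesis using True i by simp
  next
    case False
    have "(\<integral>b. g i b \<partial>acceptance) = 0"
      using False accept_prob by (simp add: g_def X_def algebra_simps)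
    then show ?thesis using False i by (simp add: prod_zero_iff) blast
  qed
  ultimately show ?thesis by (simp add: prod has_bochner_integral_iff)
qed

lemma acceptance_variance:
  assumes T: "T \<subseteq> players P"
  shows "has_bochner_integral acceptances (\<lambda>y. (\<Sum>i\<in>T. of_bool (y i) - accept_prob P)\<^sup>2)
    (real (card T) * (accept_prob P * (1 - accept_prob P)))"
proof -
  have fin: "finite T" using T by (rule finite_subset) simp
  have "has_bochner_integral acceptances
      (\<lambda>y. \<Sum>i\<in>T. \<Sum>j\<in>T. (of_bool (y i) - accept_prob P) * (of_bool (y j) - accept_prob P))
      (\<Sum>i\<in>T. \<Sum>j\<in>T. if i = j then accept_prob P * (1 - accept_prob P) else 0)"
    using T by (intro has_bochner_integral_sum acceptance_cross_moment) auto
  then show ?thesis using fin by (simp add: power2_eq_square sum_product)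
qed

text \<open>The mixed term vanishes with the mean of the noise. The shift s will be the centred
  count at fixed decisions.\<close>

lemma count_noise_second_moment:
  "has_bochner_integral count_noise_law (\<lambda>z. (s + z)\<^sup>2) (s\<^sup>2 + 2 / (privacy P)\<^sup>2)"
proof -
  interpret prob_space count_noise_law using privacy_pos by (intro prob_space_laplace) simp
  have "has_bochner_integral count_noise_law (\<lambda>z. s\<^sup>2 + (2 * s) * z + z\<^sup>2)
      (s\<^sup>2 + (2 * s) * 0 + fact 2 * (1 / privacy P)\<^sup>2)"
    using privacy_pos
    by (intro has_bochner_integral_add has_bochner_integral_mult_right laplace_mean laplace_moment)
      (auto simp: has_bochner_integral_iff prob_space[simplified])
  then show ?thesis by (simp add: power2_sum power_divide fact_2 add_ac mult_ac)
qed

text \<open>Chebyshev's inequality in two stages: for fixed decisions, Markov's inequality for the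
  square of centred count plus noise; then the mean of the resulting bound over the
  decisions.\<close>

lemma estimate_tail:
  assumes D: "D \<in> databases P" and k: "0 < k"
  defines "N \<equiv> card {i \<in> players P. code P (D i) = target P}"
  shows "\<P>((v, A, z, w) in randomness P D. k \<le> \<bar>estimate P D (truthful P D v A) z - real N\<bar>) \<le>
    (real N * (accept_prob P * (1 - accept_prob P)) + 2 / (privacy P)\<^sup>2) / (accept_prob P * k)\<^sup>2"
proof -
  interpret Z: prob_space count_noise_law using privacy_pos by (intro prob_space_laplace) simp
  define T where "T = {i \<in> players P. code P (D i) = target P}"
  have T: "T \<subseteq> players P" "finite T" "N = card T" by (auto simp: T_def N_def)
  have NT: "N \<le> num_players P"
    using card_mono[OF finite_players T(1)] by (simp add: T(3))
  define S where "S y = (\<Sum>i\<in>T. of_bool (y i) - accept_prob P)" for y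
  let ?c = "accept_prob P"
  let ?K = "(?c * k)\<^sup>2"
  have K: "0 < ?K" using accept_prob k by simp
  have le: "emeasure count_noise_law {z. k \<le> \<bar>estimate P D y z - real N\<bar>} \<le>
      ennreal (((S y)\<^sup>2 + 2 / (privacy P)\<^sup>2) / ?K)" for y
  proof -
    have "{i \<in> players P. y i \<and> code P (D i) = target P} = {i \<in> T. y i}" by (auto simp: T_def)
    then have "real (card {i \<in> players P. y i \<and> code P (D i) = target P}) = (\<Sum>i\<in>T. of_bool (y i))"
      using T(2) by (simp add: of_bool_def sum.If_cases Int_def)
    \<comment> \<open>S y is the centred count, so before truncation the estimate is N plus the
      error (S y + z) / c.\<close>
    also have "\<dots> = S y + real N * ?c" by (simp add: S_def sum_subtractf T(3))
    finally have est: "estimate P D y z = max 0 (min (real (num_players P)) (real N + (S y + z) / ?c))" for z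
      using accept_prob by (simp add: estimate_eq add_divide_distrib algebra_simps)
    \<comment> \<open>Truncation is the projection onto the interval from 0 to n. It fixes N, which
      lies in that interval, and does not increase distances.\<close>
    have clamp: "\<bar>max 0 (min (real (num_players P)) (real N + x)) - real N\<bar> \<le> \<bar>x\<bar>" for x
      using NT by auto
    have sub: "{z. k \<le> \<bar>estimate P D y z - real N\<bar>} \<subseteq> {z \<in> space count_noise_law. ?K \<le> (S y + z)\<^sup>2}"
    proof safe
      fix z assume "k \<le> \<bar>estimate P D y z - real N\<bar>"
      also have "\<dots> \<le> \<bar>(S y + z) / ?c\<bar>" unfolding est by (rule clamp)
      finally have "?c * k \<le> \<bar>S y + z\<bar>" using accept_prob by (simp add: field_simps)
      then have "?K \<le> \<bar>S y + z\<bar>\<^sup>2" using accept_prob k by (intro power_mono) auto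
      then show "?K \<le> (S y + z)\<^sup>2" by simp
    qed simp
    have "measure count_noise_law {z. k \<le> \<bar>estimate P D y z - real N\<bar>} \<le>
        measure count_noise_law {z \<in> space count_noise_law. ?K \<le> (S y + z)\<^sup>2}"
      using sub by (intro Z.finite_measure_mono) simp_all
    also have "\<dots> \<le> (\<integral>z. (S y + z)\<^sup>2 \<partial>count_noise_law) / ?K"
      using count_noise_second_moment[of "S y"] K
      by (intro integral_Markov_inequality_measure[where A = "{}"]) (auto simp: has_bochner_integral_iff)
    also have "(\<integral>z. (S y + z)\<^sup>2 \<partial>count_noise_law) = (S y)\<^sup>2 + 2 / (privacy P)\<^sup>2"
      using count_noise_second_moment by (simp add: has_bochner_integral_iff)
    finally show ?thesis by (simp add: Z.emeasure_eq_measure ennreal_leI)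
  qed
  interpret Y: prob_space acceptances by (intro prob_space_PiM prob_space_measure_pmf)
  have mean: "has_bochner_integral acceptances (\<lambda>y. ((S y)\<^sup>2 + 2 / (privacy P)\<^sup>2) / ?K)
      ((real N * (?c * (1 - ?c)) + 2 / (privacy P)\<^sup>2) / ?K)"
    unfolding S_def using acceptance_variance[OF T(1)] T(3)
    by (intro has_bochner_integral_divide_zero has_bochner_integral_add)
      (auto simp: has_bochner_integral_iff Y.prob_space)
  have "ennreal (\<P>((v, A, z, w) in randomness P D. k \<le> \<bar>estimate P D (truthful P D v A) z - real N\<bar>)) =
      (\<integral>\<^sup>+y. emeasure count_noise_law {z. k \<le> \<bar>estimate P D y z - real N\<bar>} \<partial>acceptances)"
    by (rule estimate_prob[OF D]) measurable
  also have "\<dots> \<le> (\<integral>\<^sup>+y. ennreal (((S y)\<^sup>2 + 2 / (privacy P)\<^sup>2) / ?K) \<partial>acceptances)"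
    using le by (intro nn_integral_mono)
  also have "\<dots> = ennreal ((real N * (?c * (1 - ?c)) + 2 / (privacy P)\<^sup>2) / ?K)"
    using mean by (subst nn_integral_eq_integral) (auto simp: has_bochner_integral_iff)
  finally show ?thesis using accept_prob by (simp add: ennreal_le_iff)
qed

text \<open>Multiplied by c^2, the hypothesis says that the variance of the count is at most 2 /
  eps^2, the variance of the noise, so the total is at most 4 / eps^2. With k = 4 / (c0 eps) and c
  >= c0 the denominator (c k)^2 is at least 16 / eps^2, so the tail is at most 1 / 4.\<close>

lemma mechanism_accurate:
  assumes N: "\<And>D. D \<in> databases P \<Longrightarrow> N D = card {i \<in> players P. code P (D i) = target P}"
    and c0: "0 < c0" "c0 \<le> accept_prob P"
    and n: "real (num_players P) * (1 - accept_prob P) / accept_prob P \<le> 2 / ((privacy P)\<^sup>2 * (accept_prob P)\<^sup>2)"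
  shows "accurate P N (4 / c0 / privacy P)"
  unfolding accurate_def
proof
  fix D assume D: "D \<in> databases P"
  let ?c = "accept_prob P" and ?e = "privacy P"
  let ?k = "4 / c0 / ?e"
  have k: "0 < ?k" using c0 privacy_pos by simp
  have "N D \<le> num_players P"
    unfolding N[OF D] using card_mono[OF finite_players, of "{i \<in> players P. code P (D i) = target P}"]
    by auto
  then have "real (N D) * (?c * (1 - ?c)) \<le> real (num_players P) * (?c * (1 - ?c))"
    using accept_prob by (intro mult_right_mono) auto
  also have "\<dots> = ?c\<^sup>2 * (real (num_players P) * (1 - ?c) / ?c)"
    using accept_prob by (simp add: power2_eq_square field_simps)
  also have "\<dots> \<le> ?c\<^sup>2 * (2 / (?e\<^sup>2 * ?c\<^sup>2))" using n by (rule mult_left_mono) simp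
  also have "\<dots> = 2 / ?e\<^sup>2" using accept_prob by simp
  finally have var: "real (N D) * (?c * (1 - ?c)) + 2 / ?e\<^sup>2 \<le> 4 / ?e\<^sup>2" by simp
  have "(4 / ?e)\<^sup>2 \<le> (?c * ?k)\<^sup>2"
    using c0 privacy_pos by (intro power_mono) (auto simp: field_simps)
  then have K: "16 / ?e\<^sup>2 \<le> (?c * ?k)\<^sup>2" by (simp add: power_divide)
  have "\<P>((v, A, z, w) in randomness P D. ?k \<le> \<bar>estimate P D (truthful P D v A) z - real (N D)\<bar>) \<le>
      (real (N D) * (?c * (1 - ?c)) + 2 / ?e\<^sup>2) / (?c * ?k)\<^sup>2"
    using estimate_tail[OF D k] unfolding N[OF D] .
  also have "\<dots> \<le> (4 / ?e\<^sup>2) / (16 / ?e\<^sup>2)"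
    using var K privacy_pos accept_prob by (intro frac_le) auto
  also have "\<dots> \<le> 1 / 3" using privacy_pos by simp
  finally show "\<P>((v, A, z, w) in randomness P D. ?k \<le> \<bar>estimate P D (truthful P D v A) z - real (N D)\<bar>) \<le> 1 / 3" .
qed

end

section \<open>Single-attribute and multi-attribute databases as instances\<close>

lemma single_attribute_sel:
  "players (single_attribute n h \<epsilon> c F l u G) = {1..n}"
  "num_players (single_attribute n h \<epsilon> c F l u G) = n"
  "data_values (single_attribute n h \<epsilon> c F l u G) = {1..h}"
  "databases (single_attribute n h \<epsilon> c F l u G) = {1..n} \<rightarrow>\<^sub>E {1..h}"
  "code (single_attribute n h \<epsilon> c F l u G) = (\<lambda>x. x)"
  "num_codes (single_attribute n h \<epsilon> c F l u G) = h"
  "target (single_attribute n h \<epsilon> c F l u G) = 1"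
  "privacy (single_attribute n h \<epsilon> c F l u G) = \<epsilon>"
  "accept_prob (single_attribute n h \<epsilon> c F l u G) = c"
  "cost_dist (single_attribute n h \<epsilon> c F l u G) = F"
  "thr_lo (single_attribute n h \<epsilon> c F l u G) = l"
  "thr_hi (single_attribute n h \<epsilon> c F l u G) = u"
  "prior (single_attribute n h \<epsilon> c F l u G) = G"
  by (simp_all add: single_attribute_def players_def databases_def)

lemma multi_attribute_sel:
  "players (multi_attribute n h d enc a \<epsilon> c F l u G) = {1..n}"
  "num_players (multi_attribute n h d enc a \<epsilon> c F l u G) = n"
  "data_values (multi_attribute n h d enc a \<epsilon> c F l u G) = records h d"
  "databases (multi_attribute n h d enc a \<epsilon> c F l u G) = {1..n} \<rightarrow>\<^sub>E records h d"
  "code (multi_attribute n h d enc a \<epsilon> c F l u G) = enc"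
  "num_codes (multi_attribute n h d enc a \<epsilon> c F l u G) = h ^ d"
  "target (multi_attribute n h d enc a \<epsilon> c F l u G) = enc a"
  "privacy (multi_attribute n h d enc a \<epsilon> c F l u G) = \<epsilon>"
  "accept_prob (multi_attribute n h d enc a \<epsilon> c F l u G) = c"
  "cost_dist (multi_attribute n h d enc a \<epsilon> c F l u G) = F"
  "thr_lo (multi_attribute n h d enc a \<epsilon> c F l u G) = l"
  "thr_hi (multi_attribute n h d enc a \<epsilon> c F l u G) = u"
  "prior (multi_attribute n h d enc a \<epsilon> c F l u G) = G"
  by (simp_all add: multi_attribute_def players_def databases_def)

lemma admissibleD:
  assumes "admissible n h \<epsilon> c F l u"
  shows "1 \<le> h" "0 < \<epsilon>" "0 < c" "c < 1"
    and "\<And>j. j \<in> {1..h} \<Longrightarrow> real_distribution (F j)"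
    and "\<And>j. j \<in> {1..h} \<Longrightarrow> continuous_on UNIV (cdf (F j)) \<or> discrete_distribution (F j)"
    and "\<And>j. j \<in> {1..h} \<Longrightarrow> thresholds (F j) c (l j) (u j)"
  using assms unfolding admissible_def by blast+

lemma count_mechanism_single_attribute:
  assumes "admissible n h \<epsilon> c F l u" "set_pmf G \<subseteq> ({1..n} \<rightarrow>\<^sub>E {1..h})"
  shows "count_mechanism (single_attribute n h \<epsilon> c F l u G)"
  by (rule count_mechanism.intro; unfold single_attribute_sel;
      (rule admissibleD[OF assms(1)] assms(2) finite_atLeastAtMost)?; assumption?)

lemma count_mechanism_multi_attribute:
  assumes "bij_betw enc (records h d) {1..h ^ d}"
    "admissible n (h ^ d) \<epsilon> c F l u" "set_pmf G \<subseteq> ({1..n} \<rightarrow>\<^sub>E records h d)"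
  shows "count_mechanism (multi_attribute n h d enc a \<epsilon> c F l u G)"
proof -
  have fin: "finite (records h d)" unfolding records_def by (intro finite_PiE) auto
  have enc: "enc x \<in> {1..h ^ d}" if "x \<in> records h d" for x
    using bij_betwE[OF assms(1)] that by blast
  show ?thesis
    by (rule count_mechanism.intro; unfold multi_attribute_sel;
        (rule admissibleD[OF assms(2)] assms(3) fin enc)?; assumption?)
qed

text \<open>Records are undefined off the attributes, so agreement in all d attributes is equality
  of records, which the injective encoding preserves and reflects.\<close>

lemma multi_attribute_count:
  assumes enc: "bij_betw enc (records h d) {1..h ^ d}" and a: "a \<in> records h d"
    and D: "D \<in> {1..n} \<rightarrow>\<^sub>E records h d"
  shows "card {i \<in> {1..n}. \<forall>j\<in>{1..d}. D i j = a j} = card {i \<in> {1..n}. enc (D i) = enc a}"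
proof -
  have "(\<forall>j\<in>{1..d}. D i j = a j) \<longleftrightarrow> enc (D i) = enc a" if "i \<in> {1..n}" for i
  proof -
    have Di: "D i \<in> records h d"
      using D that by (rule PiE_mem)
    have "(\<forall>j\<in>{1..d}. D i j = a j) \<longleftrightarrow> D i = a"
      using Di a unfolding records_def by (auto intro: PiE_ext)
    also have "\<dots> \<longleftrightarrow> enc (D i) = enc a"
      using bij_betw_imp_inj_on[OF enc] Di a by (auto dest: inj_onD)
    finally show ?thesis .
  qed
  then show ?thesis by (intro arg_cong[where f = card]) auto
qed

theorem theorem3p9:
  shows
   "(\<forall>n h \<epsilon> c F l u G.
       admissible n h \<epsilon> c F l u \<and> set_pmf G \<subseteq> ({1..n} \<rightarrow>\<^sub>E {1..h}) \<longrightarrow>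
       (let P = single_attribute n h \<epsilon> c F l u G in
          bayesian_incentive_compatible P \<and> ex_interim_individually_rational P \<and>
          perfectly_data_private P \<and> differentially_private P \<epsilon>))
    \<and>
    (\<forall>c0\<in>{0<..<1::real}. \<exists>C::real. \<forall>n h \<epsilon> c F l u G.
       admissible n h \<epsilon> c F l u \<and> set_pmf G \<subseteq> ({1..n} \<rightarrow>\<^sub>E {1..h}) \<and>
       c0 \<le> c \<and> real n * (1 - c) / c \<le> 2 / (\<epsilon>\<^sup>2 * c\<^sup>2) \<longrightarrow>
       accurate (single_attribute n h \<epsilon> c F l u G) (\<lambda>D. card {i\<in>{1..n}. D i = 1}) (C / \<epsilon>))
    \<and>
    (\<forall>n h d enc a \<epsilon> c F l u G.
       1 \<le> h \<and> 1 \<le> d \<and> bij_betw enc (records h d) {1..h ^ d} \<and> a \<in> records h d \<and>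
       admissible n (h ^ d) \<epsilon> c F l u \<and> set_pmf G \<subseteq> ({1..n} \<rightarrow>\<^sub>E records h d) \<longrightarrow>
       (let P = multi_attribute n h d enc a \<epsilon> c F l u G in
          bayesian_incentive_compatible P \<and> ex_interim_individually_rational P \<and>
          perfectly_data_private P \<and> differentially_private P \<epsilon>))
    \<and>
    (\<forall>c0\<in>{0<..<1::real}. \<exists>C::real. \<forall>n h d enc a \<epsilon> c F l u G.
       1 \<le> h \<and> 1 \<le> d \<and> bij_betw enc (records h d) {1..h ^ d} \<and> a \<in> records h d \<and>
       admissible n (h ^ d) \<epsilon> c F l u \<and> set_pmf G \<subseteq> ({1..n} \<rightarrow>\<^sub>E records h d) \<and>
       c0 \<le> c \<and> real n * (1 - c) / c \<le> 2 / (\<epsilon>\<^sup>2 * c\<^sup>2) \<longrightarrow>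
       accurate (multi_attribute n h d enc a \<epsilon> c F l u G)
         (\<lambda>D. card {i\<in>{1..n}. \<forall>j\<in>{1..d}. D i j = a j}) (C / \<epsilon>))"
proof (intro conjI allI ballI impI)
  fix n h :: nat and \<epsilon> c :: real and F :: "nat \<Rightarrow> real measure" and l u :: "nat \<Rightarrow> real"
    and G :: "(nat \<Rightarrow> nat) pmf"
  assume "admissible n h \<epsilon> c F l u \<and> set_pmf G \<subseteq> ({1..n} \<rightarrow>\<^sub>E {1..h})"
  then interpret count_mechanism "single_attribute n h \<epsilon> c F l u G"
    by (blast intro: count_mechanism_single_attribute)
  show "let P = single_attribute n h \<epsilon> c F l u G in
          bayesian_incentive_compatible P \<and> ex_interim_individually_rational P \<and>
          perfectly_data_private P \<and> differentially_private P \<epsilon>"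
    unfolding Let_def
    using incentive_compatible individually_rational data_private mechanism_private[unfolded single_attribute_sel]
    by blast
next
  fix c0 :: real assume c0: "c0 \<in> {0<..<1}"
  show "\<exists>C::real. \<forall>n h \<epsilon> c F l u G.
       admissible n h \<epsilon> c F l u \<and> set_pmf G \<subseteq> ({1..n} \<rightarrow>\<^sub>E {1..h}) \<and>
       c0 \<le> c \<and> real n * (1 - c) / c \<le> 2 / (\<epsilon>\<^sup>2 * c\<^sup>2) \<longrightarrow>
       accurate (single_attribute n h \<epsilon> c F l u G) (\<lambda>D. card {i\<in>{1..n}. D i = 1}) (C / \<epsilon>)"
  \<comment> \<open>The constant of \<open>mechanism_accurate\<close>, which involves c0 but none of
    the parameters quantified after it.\<close>
  proof (intro exI[of _ "4 / c0"] allI impI)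
    fix n h :: nat and \<epsilon> c :: real and F :: "nat \<Rightarrow> real measure" and l u :: "nat \<Rightarrow> real"
      and G :: "(nat \<Rightarrow> nat) pmf"
    assume *: "admissible n h \<epsilon> c F l u \<and> set_pmf G \<subseteq> ({1..n} \<rightarrow>\<^sub>E {1..h}) \<and>
       c0 \<le> c \<and> real n * (1 - c) / c \<le> 2 / (\<epsilon>\<^sup>2 * c\<^sup>2)"
    then interpret count_mechanism "single_attribute n h \<epsilon> c F l u G"
      by (blast intro: count_mechanism_single_attribute)
    show "accurate (single_attribute n h \<epsilon> c F l u G) (\<lambda>D. card {i\<in>{1..n}. D i = 1}) (4 / c0 / \<epsilon>)"
      by (rule mechanism_accurate[unfolded single_attribute_sel]) (use * c0 in simp_all)
  qed
next
  fix n h d :: nat and enc a and \<epsilon> c :: real and F :: "nat \<Rightarrow> real measure" and l u :: "nat \<Rightarrow> real"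
    and G :: "(nat \<Rightarrow> nat \<Rightarrow> nat) pmf"
  assume "1 \<le> h \<and> 1 \<le> d \<and> bij_betw enc (records h d) {1..h ^ d} \<and> a \<in> records h d \<and>
       admissible n (h ^ d) \<epsilon> c F l u \<and> set_pmf G \<subseteq> ({1..n} \<rightarrow>\<^sub>E records h d)"
  then interpret count_mechanism "multi_attribute n h d enc a \<epsilon> c F l u G"
    by (blast intro: count_mechanism_multi_attribute)
  show "let P = multi_attribute n h d enc a \<epsilon> c F l u G in
          bayesian_incentive_compatible P \<and> ex_interim_individually_rational P \<and>
          perfectly_data_private P \<and> differentially_private P \<epsilon>"
    unfolding Let_def
    using incentive_compatible individually_rational data_private mechanism_private[unfolded multi_attribute_sel]
    by blast
next
  fix c0 :: real assume c0: "c0 \<in> {0<..<1}"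
  show "\<exists>C::real. \<forall>n h d enc a \<epsilon> c F l u G.
       1 \<le> h \<and> 1 \<le> d \<and> bij_betw enc (records h d) {1..h ^ d} \<and> a \<in> records h d \<and>
       admissible n (h ^ d) \<epsilon> c F l u \<and> set_pmf G \<subseteq> ({1..n} \<rightarrow>\<^sub>E records h d) \<and>
       c0 \<le> c \<and> real n * (1 - c) / c \<le> 2 / (\<epsilon>\<^sup>2 * c\<^sup>2) \<longrightarrow>
       accurate (multi_attribute n h d enc a \<epsilon> c F l u G)
         (\<lambda>D. card {i\<in>{1..n}. \<forall>j\<in>{1..d}. D i j = a j}) (C / \<epsilon>)"
  proof (intro exI[of _ "4 / c0"] allI impI)
    fix n h d :: nat and enc a and \<epsilon> c :: real and F :: "nat \<Rightarrow> real measure" and l u :: "nat \<Rightarrow> real"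
      and G :: "(nat \<Rightarrow> nat \<Rightarrow> nat) pmf"
    let ?P = "multi_attribute n h d enc a \<epsilon> c F l u G"
    assume *: "1 \<le> h \<and> 1 \<le> d \<and> bij_betw enc (records h d) {1..h ^ d} \<and> a \<in> records h d \<and>
       admissible n (h ^ d) \<epsilon> c F l u \<and> set_pmf G \<subseteq> ({1..n} \<rightarrow>\<^sub>E records h d) \<and>
       c0 \<le> c \<and> real n * (1 - c) / c \<le> 2 / (\<epsilon>\<^sup>2 * c\<^sup>2)"
    then interpret count_mechanism ?P
      by (blast intro: count_mechanism_multi_attribute)
    show "accurate ?P (\<lambda>D. card {i\<in>{1..n}. \<forall>j\<in>{1..d}. D i j = a j}) (4 / c0 / \<epsilon>)"
    proof (rule mechanism_accurate[unfolded multi_attribute_sel])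
      show "card {i\<in>{1..n}. \<forall>j\<in>{1..d}. D i j = a j} = card {i\<in>{1..n}. enc (D i) = enc a}"
        if "D \<in> {1..n} \<rightarrow>\<^sub>E records h d" for D
        by (rule multi_attribute_count[OF _ _ that]) (use * in blast)+
    qed (use * c0 in simp_all)
  qed
qed

end
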